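(* Suppose that $\Theta=(\theta_m)_{m\in\mathbb{N}}$ satisfies the standing assumptions (A) stated in the context and that $\mathfrak{S}_n$ is endowed with $\mathbb{P}_\Theta$. Then for each fixed $b\in\mathbb{N}$, as $n\to\infty$, $$(C_1,C_2,\ldots,C_b)\stackrel{d}{\longrightarrow}(Y_1,\ldots,Y_b),$$ where $Y_1,\ldots,Y_b$ are independent Poisson distributed random variables with $\mathbb{E}[Y_m]=\frac{\theta_m}{m}$.
   Context: $\mathfrak{S}_n$ is the symmetric group on $\{1,\dots,n\}$, and for $\sigma\in\mathfrak{S}_n$, $C_m=C_m(\sigma)$ is the number of cycles of length $m$ in the cycle decomposition of $\sigma$. For $\Theta=(\theta_m)_{m\ge1}$ with $\theta_m\ge 0$, the probability measure $\mathbb{P}_\Theta$ on $\mathfrak{S}_n$ is $\mathbb{P}_\Theta[\sigma]=\frac{1}{h_n n!}\prod_{m=1}^n\theta_m^{C_m(\sigma)}$, with $h_n=h_n(\Theta)$ the normalization constant and $h_0:=1$. Put $g_\Theta(t)=\sum_{m\ge1}\frac{\theta_m}{m}t^m$. Standing assumptions (A): $\theta_m\ge0$ for all $m\ge 1$; $g_\Theta$ is holomorphic for $|t|<1$; $g_\Theta$ is continuous (extends continuously) in the punctured disc $\{|t|\le1,\ t\ne1\}$; and there exist an integer $k\ge1$ and a polynomial $P(r)=\frac{r^{k+1}}{k+1}+\sum_{j=0}^k c_jr^j$ with real $c_j$ such that $g_\Theta(e^{-w})=P(-\log w)+O(w)$ as $w\to0$, $\mathrm{Re}(w)\ge0$ (principal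 branch of $\log$). *)

theory Defs
  imports
    "HOL-Probability.Probability"
    "HOL-Complex_Analysis.Complex_Analysis"
    "HOL-Combinatorics.Orbits"
    "HOL-Library.Landau_Symbols"
begin

text \<open>
  The set \<^term>\<open>{1..n}\<close> is a parameter because \<open>\<sigma>\<close> is a function on all of \<^typ>\<open>nat\<close> fixing
  everything outside it: fixed points in \<^term>\<open>{1..n}\<close> are cycles of length 1,
  those outside are not counted.
\<close>
definition cycle_count :: "nat \<Rightarrow> (nat \<Rightarrow> nat) \<Rightarrow> nat \<Rightarrow> nat" where
  "cycle_count n \<sigma> m = card {c \<in> orbit \<sigma> ` {1..n}. card c = m}"

definition cycle_weight :: "(nat \<Rightarrow> real) \<Rightarrow> nat \<Rightarrow> (nat \<Rightarrow> nat) \<Rightarrow> real" where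
  "cycle_weight \<theta> n \<sigma> = (\<Prod>m = 1..n. \<theta> m ^ cycle_count n \<sigma> m)"

definition norm_const :: "(nat \<Rightarrow> real) \<Rightarrow> nat \<Rightarrow> real" where
  "norm_const \<theta> n = (\<Sum>\<sigma> | \<sigma> permutes {1..n}. cycle_weight \<theta> n \<sigma>) / fact n"

text \<open>
  If \<^term>\<open>norm_const \<theta> n = 0\<close>, which is possible for small \<open>n\<close>, the weighted probability
  measure does not exist and this is the zero measure.
\<close>
definition perm_measure :: "(nat \<Rightarrow> real) \<Rightarrow> nat \<Rightarrow> (nat \<Rightarrow> nat) measure" where
  "perm_measure \<theta> n = point_measure {\<sigma>. \<sigma> permutes {1..n}}
     (\<lambda>\<sigma>. ennreal (1 / (norm_const \<theta> n * fact n) * cycle_weight \<theta> n \<sigma>))"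

definition g_coeff :: "(nat \<Rightarrow> real) \<Rightarrow> nat \<Rightarrow> complex" where
  "g_coeff \<theta> m = (if m = 0 then 0 else complex_of_real (\<theta> m / real m))"

definition g_fun :: "(nat \<Rightarrow> real) \<Rightarrow> complex \<Rightarrow> complex" where
  "g_fun \<theta> t = (\<Sum>m. g_coeff \<theta> m * t ^ m)"

text \<open>
  Summability is required explicitly because \<^const>\<open>suminf\<close> also has a value on divergent series.
  The function \<open>G\<close> is the (unique) continuous extension of the power series to the
  punctured closed disc; the expansion at \<open>1\<close> concerns \<open>G\<close>, since \<open>exp (- w)\<close> lies on the unit
  circle when \<open>Re w = 0\<close>.
\<close>
definition standing_assumptions :: "(nat \<Rightarrow> real) \<Rightarrow> bool" where
  "standing_assumptions \<theta> \<longleftrightarrow>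
     (\<forall>m\<ge>1. 0 \<le> \<theta> m) \<and>
     (\<forall>t. norm t < 1 \<longrightarrow> summable (\<lambda>m. g_coeff \<theta> m * t ^ m)) \<and>
     g_fun \<theta> holomorphic_on ball 0 1 \<and>
     (\<exists>G. continuous_on (cball 0 1 - {1}) G \<and>
          (\<forall>t\<in>ball 0 1. G t = g_fun \<theta> t) \<and>
          (\<exists>k\<ge>1. \<exists>c :: nat \<Rightarrow> real.
             let P = (\<lambda>r :: complex. r ^ (k + 1) / of_nat (k + 1)
                        + (\<Sum>j = 0..k. complex_of_real (c j) * r ^ j))
             in (\<lambda>w. G (exp (- w)) - P (- Ln w)) \<in> O[at 0 within {w. 0 \<le> Re w}](\<lambda>w. w)))"

text \<open>
  Unlike \<open>poisson_pmf\<close>, which presupposes a positive rate, this includes the rate \<open>0\<close>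
  (point mass at \<open>0\<close>, as \<^term>\<open>(0::real) ^ 0 = 1\<close>), needed when some \<open>\<theta> m\<close> vanishes.
\<close>
definition poisson_density :: "real \<Rightarrow> nat \<Rightarrow> real" where
  "poisson_density \<mu> j = \<mu> ^ j / fact j * exp (- \<mu>)"

text \<open>
  Weak convergence of the laws of \<open>X n\<close>, each on its own space \<open>M n\<close>, to the law of \<open>Y\<close> on \<open>N\<close>,
  as random elements of the topological space \<open>T\<close>. The library notion \<open>weak_conv_m\<close> only
  covers the real line.
\<close>
definition conv_in_distr ::
  "'c topology \<Rightarrow> (nat \<Rightarrow> 'a measure) \<Rightarrow> (nat \<Rightarrow> 'a \<Rightarrow> 'c) \<Rightarrow> 'b measure \<Rightarrow> ('b \<Rightarrow> 'c) \<Rightarrow> bool" where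
  "conv_in_distr T M X N Y \<longleftrightarrow>
     (\<forall>f :: 'c \<Rightarrow> real. continuous_map T euclideanreal f \<and> bounded (f ` topspace T) \<longrightarrow>
        (\<lambda>n. \<integral>x. f (X n x) \<partial>M n) \<longlonglongrightarrow> (\<integral>y. f (Y y) \<partial>N))"

end

theory Submission
  imports
    Defs
    "HOL-Real_Asymp.Real_Asymp"
begin

text \<open>
  Let \<open>h\<^sub>n\<close> be the coefficients of \<open>exp g\<close>. Splitting off the cycle through a fixed element shows that
  \<open>\<bbbP>(C\<^sub>1 = c\<^sub>1, \<dots>, C\<^sub>b = c\<^sub>b)\<close> equals \<open>\<Prod>\<^sub>m (\<theta>\<^sub>m/m)\<^bsup>c\<^sub>m\<^esup> / c\<^sub>m!\<close> times \<open>[t\<^bsup>n-s\<^esup>] (q exp g) / h\<^sub>n\<close>, where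
  \<open>s = \<Sum> m c\<^sub>m\<close> and \<open>q\<close> is the entire function \<open>exp (- \<Sum>\<^bsub>m\<le>b\<^esub> \<theta>\<^sub>m t\<^sup>m / m)\<close>. If \<open>h\<^bsub>n-1\<^esub> / h\<^sub>n \<longlongrightarrow> 1\<close>, the quotient
  tends to \<open>q(1)\<close> by Tannery's theorem, which gives the product of the Poisson weights.

  The ratio limit comes from a saddle point computation. On the circle of radius \<open>exp (- e\<^bsup>-L\<^esup>)\<close>, with
  \<open>P'(L) e\<^sup>L = n\<close>, the integrand of Cauchy's formula is concentrated around the positive axis with a Gaussian
  profile of relative width \<open>L\<^bsup>-k/2\<^esup>\<close>, because \<open>P'(L)\<close> tends to infinity. The profile is the same for the
  coefficients \<open>n\<close> and \<open>n - 1\<close>. Away from \<open>t = 1\<close> the function is bounded, while at the saddle point it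
  exceeds every power of \<open>e\<^sup>L\<close>.
\<close>

subsection \<open>Polynomials in the logarithm\<close>

text \<open>Nothing is assumed about derivatives of \<open>G\<close> near 1 or about a continuation
  across the unit circle; only an \<open>O(w)\<close> expansion is at hand. So the saddle is located
  from the polynomial alone, and the expansion error enters through its size only: it vanishes
  pointwise as \<open>w\<close> tends to 0, and it is bounded by a constant on a fixed
  neighbourhood, which suffices for dominated convergence. With
  \<open>w = exp (- L) * (1 + i u)\<close> one has \<open>- Ln w = L - Ln (1 + i u)\<close>. The
  Gaussian comes from the quadratic term of \<open>Ln\<close>, multiplied by \<open>P'(L)\<close>;
  the second-order part of \<open>P\<close> itself is of lower order. For large \<open>u\<close> the
  logarithm grows too slowly for a Gaussian bound uniform in \<open>L\<close>, so the majorant is a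
  Cauchy density. The saddle is known only implicitly as a solution of an equation.\<close>

definition log_poly :: "nat \<Rightarrow> (nat \<Rightarrow> real) \<Rightarrow> 'a::real_normed_field \<Rightarrow> 'a" where
  "log_poly k c r = r ^ (k + 1) / of_nat (k + 1) + (\<Sum>j=0..k. of_real (c j) * r ^ j)"

text \<open>The derivative as an explicit formula; it is used only as the linear coefficient of a
  Taylor estimate and through its growth. For \<open>j = 0\<close> the factor
  \<open>of_nat j\<close> removes the term, whatever the truncated exponent \<open>j - 1\<close>
  gives.\<close>

definition log_poly_deriv :: "nat \<Rightarrow> (nat \<Rightarrow> real) \<Rightarrow> 'a::real_normed_field \<Rightarrow> 'a" where
  "log_poly_deriv k c r = r ^ k + (\<Sum>j=0..k. of_real (c j) * (of_nat j * r ^ (j - 1)))"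

text \<open>The saddle \<open>L\<close> is real while the polynomial is evaluated at the complex
  number \<open>- Ln w\<close>; this links the two instances of the polymorphic definition.\<close>

lemma log_poly_of_real: "log_poly k c (of_real x) = of_real (log_poly k c x)"
  by (simp add: log_poly_def)

lemma log_poly_deriv_of_real: "log_poly_deriv k c (of_real x) = of_real (log_poly_deriv k c x)"
  by (simp add: log_poly_deriv_def)

text \<open>With \<open>E\<close> the remainder for one exponent, the next remainder is
  \<open>(a + z) * E\<close> plus a multiple of \<open>a ^ (j + 1) * z ^ 2\<close>. The constant is
  not optimal but closes the induction, as
  \<open>(j + 2)^2 + (j + 2) \<le> (j + 3)^2\<close>.\<close>

lemma norm_power_taylor2:
  fixes a z :: "'a::real_normed_field"
  shows "norm ((a + z) ^ (j + 2) - a ^ (j + 2) - of_nat (j + 2) * a ^ (j + 1) * z)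
           \<le> real (j + 2) ^ 2 * (norm z)\<^sup>2 * (norm a + norm z) ^ j"
proof (induction j)
  case 0
  have eq: "(a + z) ^ (0 + 2) - a ^ (0 + 2) - of_nat (0 + 2) * a ^ (0 + 1) * z = z ^ 2"
    by (simp add: power2_eq_square algebra_simps)
  show ?case unfolding eq by (simp add: norm_power)
next
  case (Suc j)
  define E where "E = (a + z) ^ (j + 2) - a ^ (j + 2) - of_nat (j + 2) * a ^ (j + 1) * z"
  define A where "A = norm a + norm z"
  have A: "A \<ge> 0" "norm a \<le> A" "norm (a + z) \<le> A" by (auto simp: A_def norm_triangle_ineq)
  have "(a + z) ^ (Suc j + 2) - a ^ (Suc j + 2) - of_nat (Suc j + 2) * a ^ (Suc j + 1) * z
      = (a + z) * E + of_nat (j + 2) * a ^ (j + 1) * z ^ 2"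
    by (simp add: E_def power2_eq_square algebra_simps)
  also have "norm \<dots> \<le> norm (a + z) * norm E + real (j + 2) * norm a ^ (j + 1) * (norm z)\<^sup>2"
    by (rule order_trans[OF norm_triangle_ineq]) (simp only: norm_mult norm_power norm_of_nat order_refl)
  also have "\<dots> \<le> A * (real (j + 2) ^ 2 * (norm z)\<^sup>2 * A ^ j) + real (j + 2) * A ^ (j + 1) * (norm z)\<^sup>2"
    using Suc A unfolding E_def A_def[symmetric]
    by (intro add_mono mult_mono power_mono) auto
  also have "\<dots> = (real (j + 2) ^ 2 + real (j + 2)) * ((norm z)\<^sup>2 * A ^ Suc j)"
    by (simp add: algebra_simps)
  also have "\<dots> \<le> real (Suc j + 2) ^ 2 * ((norm z)\<^sup>2 * A ^ Suc j)"
    using A by (intro mult_right_mono) (auto simp: power2_eq_square algebra_simps)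
  finally show ?case by (simp add: A_def mult.assoc)
qed

text \<open>One power \<open>k - 1\<close> for all degrees up to \<open>k + 1\<close> allows the
  remainders of a whole polynomial to be summed. Since the base is at least 1, the exponent may be
  raised; degrees 0 and 1 leave no remainder.\<close>

lemma norm_power_taylor2_le:
  fixes a z :: "'a::real_normed_field"
  assumes "j \<le> k + 1" "norm a + norm z \<ge> 1" "k \<ge> 1"
  shows "norm ((a + z) ^ j - a ^ j - of_nat j * a ^ (j - 1) * z)
           \<le> real j ^ 2 * ((norm z)\<^sup>2 * (norm a + norm z) ^ (k - 1))"
proof -
  consider "j = 0" | "j = 1" | i where "j = i + 2"
    by (metis One_nat_def add_2_eq_Suc' not0_implies_Suc)
  then show ?thesis
  proof cases
    case (3 i)
    have "norm ((a + z) ^ j - a ^ j - of_nat j * a ^ (j - 1) * z) \<le> real j ^ 2 * (norm z)\<^sup>2 * (norm a + norm z) ^ i"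
      using norm_power_taylor2[of a z i] 3 by simp
    also have "\<dots> \<le> real j ^ 2 * (norm z)\<^sup>2 * (norm a + norm z) ^ (k - 1)"
      using assms 3 by (intro mult_left_mono power_increasing) auto
    finally show ?thesis by (simp add: mult.assoc)
  qed (use assms in simp_all)
qed

text \<open>The term \<open>k + 1\<close> comes from the leading monomial: its Taylor constant
  \<open>(k + 1)^2\<close> divided by its denominator \<open>k + 1\<close>.\<close>

definition log_poly_bound :: "nat \<Rightarrow> (nat \<Rightarrow> real) \<Rightarrow> real" where
  "log_poly_bound k c = real (k + 1) + (\<Sum>j=0..k. \<bar>c j\<bar> * real j ^ 2)"

lemma log_poly_bound_nonneg: "log_poly_bound k c \<ge> 0"
  unfolding log_poly_bound_def by (intro add_nonneg_nonneg sum_nonneg) auto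

text \<open>The bound has one power of \<open>norm a + norm z\<close> fewer than the growth
  \<open>a ^ k\<close> of the derivative. For \<open>a = L\<close> and \<open>z\<close> of order
  \<open>L\<close> to the power \<open>- k / 2\<close> the remainder is therefore
  \<open>O(1 / L)\<close> and does not disturb the Gaussian.\<close>

lemma norm_log_poly_taylor2:
  fixes a z :: "'a::real_normed_field"
  assumes "k \<ge> 1" "norm a + norm z \<ge> 1"
  shows "norm (log_poly k c (a + z) - log_poly k c a - log_poly_deriv k c a * z)
           \<le> log_poly_bound k c * ((norm z)\<^sup>2 * (norm a + norm z) ^ (k - 1))"
proof -
  define E where "E j = (a + z) ^ j - a ^ j - of_nat j * a ^ (j - 1) * z" for j
  define X where "X = (norm z)\<^sup>2 * (norm a + norm z) ^ (k - 1)"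
  have E: "norm (E j) \<le> real j ^ 2 * X" if "j \<le> k + 1" for j
    unfolding E_def X_def by (rule norm_power_taylor2_le[OF that assms(2,1)])
  have k0: "of_nat (k + 1) \<noteq> (0::'a)" by (simp del: of_nat_Suc of_nat_add)
  have "log_poly k c (a + z) - log_poly k c a - log_poly_deriv k c a * z
      = E (k + 1) / of_nat (k + 1) + (\<Sum>j=0..k. of_real (c j) * E j)"
  proof -
    have "E (k + 1) / of_nat (k + 1) = (a + z) ^ (k + 1) / of_nat (k + 1) - a ^ (k + 1) / of_nat (k + 1) - a ^ k * z"
      using k0 unfolding E_def diff_divide_distrib by (simp del: of_nat_Suc of_nat_add)
    moreover have "(\<Sum>j=0..k. of_real (c j) * E j) = (\<Sum>j=0..k. of_real (c j) * (a + z) ^ j) -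
        (\<Sum>j=0..k. of_real (c j) * a ^ j) - (\<Sum>j=0..k. of_real (c j) * (of_nat j * a ^ (j - 1))) * z"
      unfolding sum_distrib_right sum_subtractf[symmetric] E_def
      by (intro sum.cong) (auto simp: algebra_simps)
    ultimately show ?thesis
      unfolding log_poly_def log_poly_deriv_def by (simp add: algebra_simps)
  qed
  also have "norm \<dots> \<le> norm (E (k + 1)) / real (k + 1) + (\<Sum>j=0..k. \<bar>c j\<bar> * norm (E j))"
  proof (rule norm_triangle_le, rule add_mono)
    show "norm (\<Sum>j=0..k. of_real (c j) * E j) \<le> (\<Sum>j=0..k. \<bar>c j\<bar> * norm (E j))"
      by (rule order_trans[OF norm_sum]) (simp add: norm_mult)
  qed (simp add: norm_divide del: of_nat_Suc of_nat_add)
  also have "\<dots> \<le> real (k + 1) ^ 2 * X / real (k + 1) + (\<Sum>j=0..k. \<bar>c j\<bar> * (real j ^ 2 * X))"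
  proof (intro add_mono divide_right_mono sum_mono mult_left_mono)
    show "norm (E (k + 1)) \<le> real (k + 1) ^ 2 * X" by (rule E) simp
  qed (use E in auto)
  also have "real (k + 1) ^ 2 * X / real (k + 1) = real (k + 1) * X"
    by (simp add: power2_eq_square del: of_nat_add of_nat_Suc)
  also have "real (k + 1) * X + (\<Sum>j=0..k. \<bar>c j\<bar> * (real j ^ 2 * X)) = log_poly_bound k c * X"
    by (simp add: log_poly_bound_def sum_distrib_right distrib_right power2_eq_square mult.assoc)
  finally show ?thesis by (simp add: X_def)
qed

lemma power_diff_le:
  fixes v L :: real
  assumes "0 \<le> v" "v \<le> L" "1 \<le> L" "j \<le> k" "k \<ge> 1"
  shows "L ^ j - v ^ j \<le> real j * ((L - v) * L ^ (k - 1))"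
proof (cases j)
  case (Suc i)
  have "L ^ Suc i - v ^ Suc i \<le> real (Suc i) * ((L - v) * L ^ i)" for i
  proof (induction i)
    case (Suc i)
    have "L ^ Suc (Suc i) - v ^ Suc (Suc i) = L * (L ^ Suc i - v ^ Suc i) + (L - v) * v ^ Suc i"
      by (simp add: algebra_simps)
    also have "\<dots> \<le> L * (real (Suc i) * ((L - v) * L ^ i)) + (L - v) * L ^ Suc i"
      using assms Suc by (intro add_mono mult_left_mono power_mono) auto
    finally show ?case by (simp add: algebra_simps)
  qed simp
  then have "L ^ j - v ^ j \<le> real j * ((L - v) * L ^ i)" using Suc by blast
  also have "\<dots> \<le> real j * ((L - v) * L ^ (k - 1))"
    using assms Suc by (intro mult_left_mono power_increasing) auto
  finally show ?thesis .
qed (use assms in auto)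

text \<open>The leading term keeps the full factor \<open>L ^ k\<close> because
  \<open>v ^ (k + 1) \<le> v * L ^ k\<close>, while lower terms cost at most
  \<open>L ^ (k - 1)\<close>. For large \<open>L\<close> the leading decay wins whatever the signs
  of the \<open>c j\<close>.\<close>

lemma log_poly_real_diff_le:
  fixes v L :: real
  assumes "0 \<le> v" "v \<le> L" "1 \<le> L" "k \<ge> 1"
  shows "log_poly k c v - log_poly k c L
           \<le> - (L - v) * L ^ k / real (k + 1) + (\<Sum>j=0..k. \<bar>c j\<bar> * real j) * ((L - v) * L ^ (k - 1))"
proof -
  have "v * v ^ k \<le> v * L ^ k" using assms by (intro mult_left_mono power_mono) auto
  then have 1: "v ^ (k + 1) - L ^ (k + 1) \<le> - (L - v) * L ^ k" by (simp add: algebra_simps)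
  have "(\<Sum>j=0..k. c j * v ^ j) - (\<Sum>j=0..k. c j * L ^ j) = (\<Sum>j=0..k. c j * (v ^ j - L ^ j))"
    by (simp add: sum_subtractf algebra_simps)
  also have "\<dots> \<le> (\<Sum>j=0..k. \<bar>c j\<bar> * (real j * ((L - v) * L ^ (k - 1))))"
  proof (rule sum_mono)
    fix j assume "j \<in> {0..k}"
    have "v ^ j \<le> L ^ j" using assms by (intro power_mono) auto
    have "c j * (v ^ j - L ^ j) \<le> \<bar>c j * (v ^ j - L ^ j)\<bar>" by simp
    also have "\<dots> = \<bar>c j\<bar> * (L ^ j - v ^ j)" using \<open>v ^ j \<le> L ^ j\<close> by (simp add: abs_mult)
    also have "\<dots> \<le> \<bar>c j\<bar> * (real j * ((L - v) * L ^ (k - 1)))"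
      using power_diff_le[of v L j k] assms \<open>j \<in> _\<close> by (intro mult_left_mono) auto
    finally show "c j * (v ^ j - L ^ j) \<le> \<bar>c j\<bar> * (real j * ((L - v) * L ^ (k - 1)))" .
  qed
  finally have 2: "(\<Sum>j=0..k. c j * v ^ j) - (\<Sum>j=0..k. c j * L ^ j)
      \<le> (\<Sum>j=0..k. \<bar>c j\<bar> * real j) * ((L - v) * L ^ (k - 1))"
    by (simp add: sum_distrib_right mult.assoc)
  have "(v ^ (k + 1) - L ^ (k + 1)) / real (k + 1) \<le> - (L - v) * L ^ k / real (k + 1)"
    using 1 by (rule divide_right_mono) simp
  then show ?thesis using 2 by (simp add: log_poly_def diff_divide_distrib)
qed

text \<open>
  The first-order Taylor term at the real point \<open>v\<close> in the direction \<open>\<i> \<phi>\<close> is purely imaginary,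
  so only a quadratic error enters the real part; it is absorbed by the decay of the leading term.
\<close>
lemma Re_log_poly_decay:
  assumes "k \<ge> 1"
  obtains L0 :: real where "L0 \<ge> 1" 
    "\<And>L v \<phi> :: real. \<lbrakk>L \<ge> L0; 1 \<le> v; v \<le> L; \<bar>\<phi>\<bar> \<le> 2; \<phi>\<^sup>2 \<le> 8 * (L - v)\<rbrakk> \<Longrightarrow>
       Re (log_poly k c (Complex v (- \<phi>))) \<le> log_poly k c L - (L - v) * L ^ k / (2 * real (k + 1))"
proof -
  define B where "B = log_poly_bound k c"
  define S where "S = (\<Sum>j=0..k. \<bar>c j\<bar> * real j)"
  \<comment> \<open>\<open>T\<close> collects all terms of order \<open>L ^ (k - 1)\<close>: 8 comes
    from \<open>\<phi>\<^sup>2 \<le> 8 * (L - v)\<close>, the power of 3 from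
    \<open>v + \<bar>\<phi>\<bar> \<le> 3 * L\<close>, and \<open>S\<close> from the lower
    coefficients. The threshold \<open>2 * (k + 1) * T\<close> for \<open>L\<close> makes them use
    up at most half of the leading decay.\<close>
  define T where "T = 8 * B * 3 ^ (k - 1) + S"
  have B: "B \<ge> 0" by (simp add: B_def log_poly_bound_nonneg)
  have S: "S \<ge> 0" unfolding S_def by (intro sum_nonneg) auto
  have lin: "x \<le> y - p" if "x - y \<le> m + t" "t \<le> r" "r = q / 2" "p = q / 2" "m = - q" for x y p m t r q :: real
    using that by linarith
  show thesis
  proof (rule that)
    show "max 1 (2 * real (k + 1) * T) \<ge> 1" by simp
    fix L v \<phi> :: real
    assume h: "L \<ge> max 1 (2 * real (k + 1) * T)" "1 \<le> v" "v \<le> L" "\<bar>\<phi>\<bar> \<le> 2" "\<phi>\<^sup>2 \<le> 8 * (L - v)"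
    have "Complex v (- \<phi>) = of_real v + - (\<i> * of_real \<phi>)" by (simp add: complex_eq_iff)
    then have "log_poly k c (Complex v (- \<phi>)) - of_real (log_poly k c v) - of_real (log_poly_deriv k c v) * - (\<i> * of_real \<phi>)
        = log_poly k c (of_real v + - (\<i> * of_real \<phi>)) - log_poly k c (of_real v) - log_poly_deriv k c (of_real v) * - (\<i> * of_real \<phi>)"
      by (simp only: log_poly_of_real log_poly_deriv_of_real)
    then have "norm (log_poly k c (Complex v (- \<phi>)) - of_real (log_poly k c v) - of_real (log_poly_deriv k c v) * - (\<i> * of_real \<phi>))
        \<le> B * ((norm (- (\<i> * complex_of_real \<phi>)))\<^sup>2 * (norm (complex_of_real v) + norm (- (\<i> * complex_of_real \<phi>))) ^ (k - 1))"
      unfolding B_def using h(2) by (simp only:, intro norm_log_poly_taylor2 assms) (simp add: norm_mult)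
    also have "\<dots> = B * (\<phi>\<^sup>2 * (v + \<bar>\<phi>\<bar>) ^ (k - 1))" using h(2) by (simp add: norm_mult)
    also have "\<dots> \<le> B * ((8 * (L - v)) * (3 * L) ^ (k - 1))"
      using h B by (intro mult_left_mono mult_mono power_mono) auto
    finally have "Re (log_poly k c (Complex v (- \<phi>))) - log_poly k c v \<le> B * ((8 * (L - v)) * (3 * L) ^ (k - 1))"
      using complex_Re_le_cmod[of "log_poly k c (Complex v (- \<phi>)) - of_real (log_poly k c v) - of_real (log_poly_deriv k c v) * - (\<i> * of_real \<phi>)"]
      by simp
    moreover have "log_poly k c v - log_poly k c L
           \<le> - (L - v) * L ^ k / real (k + 1) + S * ((L - v) * L ^ (k - 1))"
      unfolding S_def using h assms by (intro log_poly_real_diff_le) auto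
    ultimately have "Re (log_poly k c (Complex v (- \<phi>))) - log_poly k c L \<le>
        - (L - v) * L ^ k / real (k + 1) + T * ((L - v) * L ^ (k - 1))"
      by (simp add: T_def algebra_simps power_mult_distrib)
    moreover have "T * ((L - v) * L ^ (k - 1)) \<le> L / (2 * real (k + 1)) * ((L - v) * L ^ (k - 1))"
    proof (intro mult_right_mono)
      show "T \<le> L / (2 * real (k + 1))" using h(1) by (simp add: field_simps)
    qed (use h in auto)
    moreover have "L / (2 * real (k + 1)) * ((L - v) * L ^ (k - 1)) = (L - v) * L ^ k / real (k + 1) / 2"
      using assms by (cases k) (auto simp: field_simps)
    moreover have "(L - v) * L ^ k / (2 * real (k + 1)) = (L - v) * L ^ k / real (k + 1) / 2"
      by (simp only: mult.commute[of 2] divide_divide_eq_left)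
    moreover have "- (L - v) * L ^ k / real (k + 1) = - ((L - v) * L ^ k / real (k + 1))"
      by (simp only: minus_mult_left[symmetric] minus_divide_left[symmetric])
    ultimately show "Re (log_poly k c (Complex v (- \<phi>))) \<le> log_poly k c L - (L - v) * L ^ k / (2 * real (k + 1))"
      by (rule lin)
  qed
qed

subsection \<open>The saddle point\<close>

lemma log_poly_deriv_asymp:
  assumes "k \<ge> 1"
  shows "((\<lambda>L::real. log_poly_deriv k c L / L ^ k) \<longlongrightarrow> 1) at_top"
proof -
  have "((\<lambda>L::real. L ^ k / L ^ k + (\<Sum>j=0..k. c j * (real j * (L ^ (j - 1) / L ^ k)))) \<longlongrightarrow> 1 + (\<Sum>j=0..k. c j * (real j * 0))) at_top"
  proof (intro tendsto_intros)
    show "((\<lambda>L::real. L ^ k / L ^ k) \<longlongrightarrow> 1) at_top"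
      by (rule tendsto_eventually, rule eventually_mono[OF eventually_gt_at_top[of 0]]) auto
    fix j assume "j \<in> {0..k}"
    show "((\<lambda>L::real. L ^ (j - 1) / L ^ k) \<longlongrightarrow> 0) at_top"
    proof (rule Lim_null_comparison)
      show "((\<lambda>L::real. inverse L) \<longlongrightarrow> 0) at_top" by (rule tendsto_inverse_0_at_top[OF filterlim_ident])
      show "\<forall>\<^sub>F L in at_top. norm (L ^ (j - 1) / L ^ k) \<le> inverse (L::real)"
      proof (rule eventually_mono[OF eventually_ge_at_top[of 1]])
        fix L :: real assume L: "L \<ge> 1"
        have "L ^ (j - 1) * L \<le> L ^ (k - 1) * L"
          using L \<open>j \<in> _\<close> by (intro mult_right_mono power_increasing) auto
        also have "\<dots> = L ^ k" using assms by (cases k) auto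
        finally show "norm (L ^ (j - 1) / L ^ k) \<le> inverse L" using L by (simp add: field_simps)
      qed
    qed
  qed
  then show ?thesis
    by (simp add: log_poly_deriv_def add_divide_distrib sum_divide_distrib)
qed

text \<open>The slope \<open>k + 1\<close> is what \<open>saddle_scale\<close> loses against
  \<open>exp (log_poly k c L)\<close>: one from the factor \<open>exp (- L)\<close>, and at most
  \<open>k\<close> from the width, since \<open>sqrt (L ^ k) \<le> exp (k * L)\<close>.\<close>

lemma log_poly_superlinear:
  assumes "k \<ge> 1"
  shows "filterlim (\<lambda>L::real. log_poly k c L - (real k + 1) * L) at_top at_top"
proof -
  define S where "S = (\<Sum>j=0..k. \<bar>c j\<bar>)"
  \<comment> \<open>Beyond this threshold the leading term is at least
    \<open>(S + k + 2) * L ^ k\<close>: \<open>S\<close> pays for the lower coefficients,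
    \<open>k + 1\<close> for the subtracted line, and one copy of \<open>L\<close> remains.\<close>
  define L0 where "L0 = max 1 (real (k + 1) * (S + real k + 2))"
  have "log_poly k c L - (real k + 1) * L \<ge> L" if L: "L \<ge> L0" for L :: real
  proof -
    have L1: "L \<ge> 1" using L by (simp add: L0_def)
    have LLk: "L \<le> L ^ k" using L1 assms by (metis power_increasing power_one_right)
    have "- (\<Sum>j=0..k. c j * L ^ j) = (\<Sum>j=0..k. - c j * L ^ j)" by (simp add: sum_negf)
    also have "\<dots> \<le> (\<Sum>j=0..k. \<bar>c j\<bar> * L ^ k)"
      using L1 by (intro sum_mono mult_mono power_increasing) auto
    finally have "- (\<Sum>j=0..k. c j * L ^ j) \<le> S * L ^ k" by (simp add: S_def sum_distrib_right)
    moreover have "(S + real k + 2) * L ^ k \<le> L / real (k + 1) * L ^ k"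
      using L L1 by (intro mult_right_mono) (auto simp: L0_def field_simps)
    moreover have "L / real (k + 1) * L ^ k = L ^ (k + 1) / real (k + 1)" by simp
    moreover have "(real k + 2) * L \<le> (real k + 2) * L ^ k" using LLk by (intro mult_left_mono) auto
    ultimately show ?thesis unfolding log_poly_def by (simp add: algebra_simps)
  qed
  then have "\<forall>\<^sub>F L in at_top. L \<le> log_poly k c L - (real k + 1) * (L::real)"
    unfolding eventually_at_top_linorder by blast
  then show ?thesis by (rule filterlim_at_top_mono[OF filterlim_ident])
qed

section \<open>The logarithm on the line \<open>1 + i u\<close>\<close>

lemma Ln_one_plus_ii_times:
  "Ln (1 + \<i> * of_real u) = Complex (ln (1 + u\<^sup>2) / 2) (arctan u)"
proof -
  have pos: "Re (1 + \<i> * of_real u) > 0" by simp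
  then have nz: "1 + \<i> * complex_of_real u \<noteq> 0" by (metis less_irrefl zero_complex.sel(1))
  have "norm (1 + \<i> * complex_of_real u) = sqrt (1 + u\<^sup>2)" by (simp add: cmod_def)
  then have "Re (Ln (1 + \<i> * of_real u)) = ln (1 + u\<^sup>2) / 2"
    using nz by (simp add: ln_sqrt add_pos_nonneg)
  moreover have "Im (Ln (1 + \<i> * of_real u)) = arctan u"
    using arg_conv_arctan[OF pos] nz by (simp add: Arg_def)
  ultimately show ?thesis by (simp add: complex_eq_iff)
qed

text \<open>The quadratic term is real and comes from the modulus alone, because
  \<open>arctan u - u\<close> is of third order. It is the source of the Gaussian.\<close>

lemma Ln_one_plus_ii_times_second_order:
  "((\<lambda>u. (Ln (1 + \<i> * of_real u) - \<i> * of_real u) / of_real (u\<^sup>2)) \<longlongrightarrow> 1 / 2) (at (0::real))"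
proof -
  have "((\<lambda>u::real. ln (1 + u\<^sup>2) / 2 / u\<^sup>2) \<longlongrightarrow> 1 / 2) (at 0)" by real_asymp
  moreover have "((\<lambda>u::real. (arctan u - u) / u\<^sup>2) \<longlongrightarrow> 0) (at 0)" by real_asymp
  ultimately have "((\<lambda>u::real. Complex (ln (1 + u\<^sup>2) / 2 / u\<^sup>2) ((arctan u - u) / u\<^sup>2)) \<longlongrightarrow> Complex (1 / 2) 0) (at 0)"
    by (rule tendsto_Complex)
  moreover have "Complex (ln (1 + u\<^sup>2) / 2 / u\<^sup>2) ((arctan u - u) / u\<^sup>2) =
      (Ln (1 + \<i> * of_real u) - \<i> * of_real u) / of_real (u\<^sup>2)" for u :: real
    unfolding Ln_one_plus_ii_times complex_eq_iff Re_divide_of_real Im_divide_of_real by simp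
  moreover have "Complex (1 / 2) 0 = 1 / 2" by (simp add: complex_eq_iff)
  ultimately show ?thesis by simp
qed

text \<open>Supplies the hypothesis \<open>\<phi>\<^sup>2 \<le> 8 * (L - v)\<close> of
  \<open>Re_log_poly_decay\<close>, where \<open>\<phi> = arctan u\<close> and
  \<open>L - v = ln (1 + u\<^sup>2) / 2\<close>. Up to \<open>\<bar>u\<bar> = 1\<close> both sides
  are comparable to \<open>u\<^sup>2\<close>; beyond, the left side is bounded and the right side
  has passed its value at 1.\<close>

lemma arctan_squared_le: "(arctan u)\<^sup>2 \<le> 4 * ln (1 + u\<^sup>2)"
proof (cases "\<bar>u\<bar> \<le> 1")
  case True
  have "\<bar>arctan u\<bar> \<le> \<bar>u\<bar>" by (rule abs_arctan_le)
  then have "(arctan u)\<^sup>2 \<le> u\<^sup>2" by (simp add: abs_le_square_iff)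
  also have "u\<^sup>2 / 2 \<le> ln (1 + u\<^sup>2)"
  proof -
    have "u\<^sup>2 \<le> 1" using True by (simp add: abs_square_le_1)
    have "ln (1 / (1 + u\<^sup>2)) \<le> 1 / (1 + u\<^sup>2) - 1" by (rule ln_le_minus_one) (simp add: add_pos_nonneg)
    moreover have "1 - 1 / (1 + u\<^sup>2) \<ge> u\<^sup>2 / 2"
    proof -
      have "u\<^sup>2 / (1 + u\<^sup>2) \<ge> u\<^sup>2 / 2" using \<open>u\<^sup>2 \<le> 1\<close> by (intro divide_left_mono) (auto simp: add_pos_nonneg)
      moreover have "1 - 1 / (1 + u\<^sup>2) = u\<^sup>2 / (1 + u\<^sup>2)"
        using add_pos_nonneg[of 1 "u\<^sup>2"] by (simp add: field_simps)
      ultimately show ?thesis by simp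
    qed
    moreover have "ln (1 / (1 + u\<^sup>2)) = - ln (1 + u\<^sup>2)"
    proof -
      have "1 + u\<^sup>2 \<noteq> 0" using zero_le_power2[of u] by linarith
      then show ?thesis by (simp add: ln_div)
    qed
    ultimately show ?thesis by linarith
  qed
  then have "u\<^sup>2 \<le> 4 * ln (1 + u\<^sup>2)" using zero_le_power2[of u] by linarith
  finally show ?thesis .
next
  case False
  have "\<bar>arctan u\<bar> \<le> pi / 2" using arctan_bounded[of u] by auto
  also have "\<dots> \<le> 1.6" using pi_approx by simp
  finally have "\<bar>arctan u\<bar>\<^sup>2 \<le> 1.6\<^sup>2" by (rule power_mono) simp
  \<comment> \<open>Numerically \<open>1.6\<^sup>2 = 2.56\<close>, which is below
    \<open>8 / 3 \<le> 4 * ln 2\<close>.\<close>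
  also have "\<dots> \<le> 4 * ln (2::real)" using ln2_ge_two_thirds by (simp add: power2_eq_square)
  also have "ln (2::real) \<le> ln (1 + u\<^sup>2)" 
    using False abs_square_le_1[of u] by simp
  finally show ?thesis by simp
qed

text \<open>Bernoulli's inequality in logarithmic form: \<open>1 + t\<close> is the convex
  combination of \<open>1\<close> and \<open>1 + q * t\<close> with weight \<open>1 / q\<close> on
  the latter. It turns a decay exponent growing with \<open>L\<close> into a bound free of
  \<open>L\<close>.\<close>

lemma ln_one_plus_scaled_le:
  assumes "q \<ge> 1" "t \<ge> (0::real)"
  shows "ln (1 + q * t) \<le> q * ln (1 + t)"
proof -
  have "(1 - 1 / q) * ln 1 + 1 / q * ln (1 + q * t) \<le> ln ((1 - 1 / q) *\<^sub>R 1 + (1 / q) *\<^sub>R (1 + q * t))"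
    using assms by (intro concave_onD[OF ln_concave]) (auto intro: add_pos_nonneg)
  also have "(1 - 1 / q) *\<^sub>R 1 + (1 / q) *\<^sub>R (1 + q * t) = 1 + t"
    using assms by (simp add: field_simps)
  finally show ?thesis using assms by (simp add: field_simps)
qed

section \<open>Pointwise limit and majorant of the rescaled integrand\<close>

lemma exp_neg_at_top: "((\<lambda>L::real. exp (- L)) \<longlongrightarrow> 0) at_top"
  by (rule filterlim_compose[OF exp_at_bot filterlim_uminus_at_bot_at_top])

text \<open>The \<open>O(w)\<close> expansion with explicit radius and constant, detached from the
  weights. The radius is at most \<open>exp (-1)\<close> so that \<open>Re (- Ln w) \<ge> 1\<close>
  on the disc, as \<open>Re_log_poly_decay\<close> requires of \<open>v\<close>.\<close>

locale log_singularity =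
  fixes G :: "complex \<Rightarrow> complex" and k :: nat and c :: "nat \<Rightarrow> real" and \<rho> C :: real
  assumes k: "k \<ge> 1" and cont: "continuous_on (cball 0 1 - {1}) G"
    and rho: "0 < \<rho>" "\<rho> \<le> exp (-1)" and C: "C \<ge> 0"
    and near: "\<And>w. Re w \<ge> 0 \<Longrightarrow> w \<noteq> 0 \<Longrightarrow> norm w \<le> \<rho> \<Longrightarrow>
                 norm (G (exp (- w)) - log_poly k c (- Ln w)) \<le> C * norm w"
begin

text \<open>\<open>L ^ k\<close> stands in for the asymptotically equal
  \<open>log_poly_deriv k c L\<close>, which may fail to be positive for small
  \<open>L\<close>.\<close>

definition saddle_width :: "real \<Rightarrow> real" where
  "saddle_width L = 1 / sqrt (L ^ k)"

definition saddle_point :: "real \<Rightarrow> real \<Rightarrow> complex" where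
  "saddle_point L s = of_real (exp (- L)) * (1 + \<i> * of_real (saddle_width L * s))"

text \<open>
  Here \<open>e\<^sup>-\<^sup>L\<close> is the abscissa of the vertical line of integration, rescaled around the real axis
  to the width of the saddle. The shift \<open>\<epsilon>\<close> allows for the coefficient \<open>n - 1\<close> to be evaluated at the
  saddle point of the coefficient \<open>n\<close>.
\<close>
definition saddle_integrand :: "real \<Rightarrow> real \<Rightarrow> real \<Rightarrow> complex" where
  "saddle_integrand \<epsilon> L s =
     indicator {y. \<bar>y\<bar> \<le> \<rho> / 2} (exp (- L) * saddle_width L * s) *
     exp (G (exp (- saddle_point L s)) - of_real (log_poly k c L)
          + \<i> * of_real ((log_poly_deriv k c L - \<epsilon> * exp (- L)) * (saddle_width L * s)))"

lemma saddle_point_Re [simp]: "Re (saddle_point L s) = exp (- L)"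
  by (simp add: saddle_point_def)

lemma saddle_point_Im [simp]: "Im (saddle_point L s) = exp (- L) * (saddle_width L * s)"
  by (simp add: saddle_point_def)

lemma saddle_point_nonzero [simp]: "saddle_point L s \<noteq> 0"
  by (metis saddle_point_Re exp_gt_zero less_irrefl zero_complex.sel(1))

lemma Ln_saddle_point: "Ln (saddle_point L s) = Ln (1 + \<i> * of_real (saddle_width L * s)) - of_real L"
proof -
  have "1 + \<i> * complex_of_real (saddle_width L * s) \<noteq> 0"
    by (auto simp: complex_eq_iff)
  moreover have "Ln (complex_of_real (exp (- L))) = of_real (- L)"
    by (subst Ln_of_real) auto
  ultimately show ?thesis unfolding saddle_point_def by (subst Ln_times_of_real) auto
qed

lemma exp_minus_mem: "Re w > 0 \<Longrightarrow> exp (- w) \<in> cball 0 1 - {1}"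
  using norm_exp_eq_Re[of "- w"] by (auto simp del: norm_exp_eq_Re) 

lemma saddle_width_squared: "L > 0 \<Longrightarrow> (saddle_width L)\<^sup>2 = 1 / L ^ k"
  by (simp add: saddle_width_def power_divide)

lemma saddle_width_tendsto: "(saddle_width \<longlongrightarrow> 0) at_top"
proof -
  have "filterlim (\<lambda>L::real. sqrt (L ^ k)) at_top at_top"
    using k by (intro filterlim_compose[OF sqrt_at_top] filterlim_pow_at_top filterlim_ident) auto
  then show ?thesis unfolding saddle_width_def
    by (intro tendsto_divide_0[OF tendsto_const] filterlim_at_top_imp_at_infinity)
qed

lemma saddle_point_tendsto: "((\<lambda>L. saddle_point L s) \<longlongrightarrow> 0) at_top"
proof -
  have "((\<lambda>L. complex_of_real (exp (- L)) * (1 + \<i> * of_real (saddle_width L * s))) \<longlongrightarrow> of_real 0 * (1 + \<i> * of_real (0 * s))) at_top"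
    by (intro tendsto_intros exp_neg_at_top saddle_width_tendsto)
  then show ?thesis by (simp add: saddle_point_def)
qed

lemma saddle_quadratic_term:
  "((\<lambda>L. of_real (log_poly_deriv k c L) * (Ln (1 + \<i> * of_real (saddle_width L * s)) - \<i> * of_real (saddle_width L * s)))
     \<longlongrightarrow> of_real (s\<^sup>2 / 2)) at_top"
\<comment> \<open>For \<open>s = 0\<close> the argument of the second-order limit is constantly 0,
  which a limit at the punctured point does not cover; the product is then identically 0.\<close>
proof (cases "s = 0")
  case False
  have "filterlim (\<lambda>L. saddle_width L * s) (at 0) at_top"
    unfolding filterlim_at
  proof (intro conjI)
    show "\<forall>\<^sub>F L in at_top. saddle_width L * s \<in> UNIV \<and> saddle_width L * s \<noteq> 0"
      by (rule eventually_mono[OF eventually_gt_at_top[of 0]]) (use False in \<open>auto simp: saddle_width_def\<close>)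
    show "((\<lambda>L. saddle_width L * s) \<longlongrightarrow> 0) at_top"
      using tendsto_mult_right[OF saddle_width_tendsto, of s] by simp
  qed
  from filterlim_compose[OF Ln_one_plus_ii_times_second_order this]
  have "((\<lambda>L. of_real (log_poly_deriv k c L / L ^ k * s\<^sup>2) *
        ((Ln (1 + \<i> * of_real (saddle_width L * s)) - \<i> * of_real (saddle_width L * s)) / of_real ((saddle_width L * s)\<^sup>2)))
     \<longlongrightarrow> of_real (1 * s\<^sup>2) * (1 / 2)) at_top"
    by (intro tendsto_mult[OF tendsto_of_real] tendsto_mult_right log_poly_deriv_asymp k)
  moreover have "\<forall>\<^sub>F L in at_top. of_real (log_poly_deriv k c L / L ^ k * s\<^sup>2) *
        ((Ln (1 + \<i> * of_real (saddle_width L * s)) - \<i> * of_real (saddle_width L * s)) / of_real ((saddle_width L * s)\<^sup>2))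
     = of_real (log_poly_deriv k c L) * (Ln (1 + \<i> * of_real (saddle_width L * s)) - \<i> * of_real (saddle_width L * s))"
  proof (rule eventually_mono[OF eventually_gt_at_top[of 0]])
    fix L :: real assume L: "L > 0"
    have "of_real (log_poly_deriv k c L / L ^ k * s\<^sup>2) * (Z / of_real ((saddle_width L * s)\<^sup>2)) =
          of_real (log_poly_deriv k c L) * Z" for Z :: complex
      using L False by (simp add: power_mult_distrib saddle_width_squared)
    then show "of_real (log_poly_deriv k c L / L ^ k * s\<^sup>2) *
        ((Ln (1 + \<i> * of_real (saddle_width L * s)) - \<i> * of_real (saddle_width L * s)) / of_real ((saddle_width L * s)\<^sup>2))
     = of_real (log_poly_deriv k c L) * (Ln (1 + \<i> * of_real (saddle_width L * s)) - \<i> * of_real (saddle_width L * s))" .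
  qed
  ultimately have "((\<lambda>L. of_real (log_poly_deriv k c L) * (Ln (1 + \<i> * of_real (saddle_width L * s)) - \<i> * of_real (saddle_width L * s)))
     \<longlongrightarrow> of_real (1 * s\<^sup>2) * (1 / 2)) at_top"
    by (rule Lim_transform_eventually)
  then show ?thesis by simp
qed simp

lemma saddle_remainder_tendsto:
  "((\<lambda>L. log_poly k c (- Ln (saddle_point L s)) - of_real (log_poly k c L)
       + of_real (log_poly_deriv k c L) * Ln (1 + \<i> * of_real (saddle_width L * s))) \<longlongrightarrow> 0) at_top"
proof (rule Lim_null_comparison)
  define B where "B = log_poly_bound k c"
  have B: "B \<ge> 0" by (simp add: B_def log_poly_bound_nonneg)
  show "((\<lambda>L. B * (4 * s\<^sup>2 * 2 ^ (k - 1)) * inverse L) \<longlongrightarrow> 0) at_top"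
    by (intro tendsto_mult_right_zero tendsto_inverse_0_at_top filterlim_ident)
  have "((\<lambda>L. saddle_width L * s) \<longlongrightarrow> 0) at_top"
    using tendsto_mult_right[OF saddle_width_tendsto, of s] by simp
  \<comment> \<open>Within this radius \<open>norm (Ln (1 + z))\<close> is at most
    \<open>2 * norm z\<close>, so the perturbation of \<open>L\<close> is at most 1.\<close>
  then have "\<forall>\<^sub>F L in at_top. \<bar>saddle_width L * s\<bar> < 1 / 2"
    by (auto dest!: tendstoD[where e = "1 / 2"])
  then show "\<forall>\<^sub>F L in at_top. norm (log_poly k c (- Ln (saddle_point L s)) - of_real (log_poly k c L)
       + of_real (log_poly_deriv k c L) * Ln (1 + \<i> * of_real (saddle_width L * s))) \<le> B * (4 * s\<^sup>2 * 2 ^ (k - 1)) * inverse L"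
    using eventually_ge_at_top[of 1]
  proof eventually_elim
    case (elim L)
    define u where "u = saddle_width L * s"
    define z where "z = Ln (1 + \<i> * of_real u)"
    have "norm (\<i> * complex_of_real u) = \<bar>u\<bar>" by (simp add: norm_mult)
    then have z: "norm z \<le> 2 * \<bar>u\<bar>" using norm_Ln_le[of "\<i> * of_real u"] elim by (simp add: u_def z_def)
    then have z1: "norm z \<le> 1" using elim by (simp add: u_def)
    have "norm (log_poly k c (of_real L + - z) - log_poly k c (of_real L) - log_poly_deriv k c (of_real L) * (- z))
      \<le> B * ((norm (- z))\<^sup>2 * (norm (complex_of_real L) + norm (- z)) ^ (k - 1))"
      unfolding B_def using elim by (intro norm_log_poly_taylor2 k) (simp add: add_increasing2)
    also have "\<dots> \<le> B * ((2 * \<bar>u\<bar>)\<^sup>2 * (2 * L) ^ (k - 1))"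
      using z z1 elim B by (intro mult_left_mono mult_mono power_mono) auto
    also have "\<dots> = B * (4 * s\<^sup>2 * 2 ^ (k - 1)) * ((saddle_width L)\<^sup>2 * L ^ (k - 1))"
      by (simp add: u_def power_mult_distrib)
    also have "(saddle_width L)\<^sup>2 * L ^ (k - 1) = inverse L"
    proof -
      have "L ^ k = L * L ^ (k - 1)" using k by (simp add: power_eq_if)
      then show ?thesis using elim by (simp add: saddle_width_squared inverse_eq_divide)
    qed
    finally show ?case
      by (simp add: Ln_saddle_point u_def[symmetric] z_def[symmetric] log_poly_of_real log_poly_deriv_of_real)
  qed
qed

text \<open>The phase \<open>i P'(L) u\<close> with \<open>u = saddle_width L * s\<close> cancels
  the linear term of \<open>- P'(L) Ln (1 + i u)\<close>; this cancellation is the saddle point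
  condition. What remains is \<open>- s\<^sup>2 / 2\<close>, up to the expansion error, the Taylor
  remainder and the phase with \<open>\<epsilon>\<close>, all of which vanish. For fixed
  \<open>s\<close> the indicator is eventually 1.\<close>

lemma saddle_integrand_tendsto:
  "((\<lambda>L. saddle_integrand \<epsilon> L s) \<longlongrightarrow> of_real (exp (- s\<^sup>2 / 2))) at_top"
proof -
  have "((\<lambda>L. G (exp (- saddle_point L s)) - log_poly k c (- Ln (saddle_point L s))) \<longlongrightarrow> 0) at_top"
  proof (rule Lim_null_comparison)
    show "((\<lambda>L. C * norm (saddle_point L s)) \<longlongrightarrow> 0) at_top"
      by (intro tendsto_mult_right_zero tendsto_norm_zero saddle_point_tendsto)
    have "\<forall>\<^sub>F L in at_top. norm (saddle_point L s) < \<rho>"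
      using tendstoD[OF saddle_point_tendsto[of s] rho(1)] by simp
    then show "\<forall>\<^sub>F L in at_top. norm (G (exp (- saddle_point L s)) - log_poly k c (- Ln (saddle_point L s))) \<le> C * norm (saddle_point L s)"
      by (rule eventually_mono) (intro near, auto)
  qed
  moreover have "((\<lambda>L. \<i> * of_real (\<epsilon> * exp (- L) * (saddle_width L * s))) \<longlongrightarrow> \<i> * of_real (\<epsilon> * 0 * (0 * s))) at_top"
    by (intro tendsto_intros exp_neg_at_top saddle_width_tendsto)
  ultimately have "((\<lambda>L. exp (((G (exp (- saddle_point L s)) - log_poly k c (- Ln (saddle_point L s)))
       + (log_poly k c (- Ln (saddle_point L s)) - of_real (log_poly k c L)
            + of_real (log_poly_deriv k c L) * Ln (1 + \<i> * of_real (saddle_width L * s)))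
       - of_real (log_poly_deriv k c L) * (Ln (1 + \<i> * of_real (saddle_width L * s)) - \<i> * of_real (saddle_width L * s)))
       - \<i> * of_real (\<epsilon> * exp (- L) * (saddle_width L * s)))) \<longlongrightarrow> exp (0 + 0 - of_real (s\<^sup>2 / 2) - \<i> * of_real (\<epsilon> * 0 * (0 * s)))) at_top"
    by (intro tendsto_exp tendsto_diff tendsto_add saddle_quadratic_term saddle_remainder_tendsto)
  moreover have "exp (0 + 0 - of_real (s\<^sup>2 / 2) - \<i> * of_real (\<epsilon> * 0 * (0 * s))) = complex_of_real (exp (- s\<^sup>2 / 2))"
    by (simp add: exp_of_real[symmetric])
  moreover have "\<forall>\<^sub>F L in at_top. exp (((G (exp (- saddle_point L s)) - log_poly k c (- Ln (saddle_point L s)))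
       + (log_poly k c (- Ln (saddle_point L s)) - of_real (log_poly k c L)
            + of_real (log_poly_deriv k c L) * Ln (1 + \<i> * of_real (saddle_width L * s)))
       - of_real (log_poly_deriv k c L) * (Ln (1 + \<i> * of_real (saddle_width L * s)) - \<i> * of_real (saddle_width L * s)))
       - \<i> * of_real (\<epsilon> * exp (- L) * (saddle_width L * s))) = saddle_integrand \<epsilon> L s"
  proof -
    have "((\<lambda>L. exp (- L) * saddle_width L * s) \<longlongrightarrow> 0 * 0 * s) at_top"
      by (intro tendsto_intros exp_neg_at_top saddle_width_tendsto)
    from tendstoD[OF this, of "\<rho> / 2"]
    have "\<forall>\<^sub>F L in at_top. \<bar>exp (- L) * saddle_width L * s\<bar> < \<rho> / 2"
      using rho(1) by (simp add: dist_real_def)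
    then show ?thesis
      by (rule eventually_mono) (auto simp: saddle_integrand_def algebra_simps)
  qed
  ultimately show ?thesis using Lim_transform_eventually by force
qed

text \<open>The phase has modulus 1, so \<open>\<epsilon>\<close> disappears. The decay of the
  polynomial gives \<open>1 + s\<^sup>2 / L ^ k\<close> to the power
  \<open>- L ^ k / (4 * (k + 1))\<close>, which \<open>ln_one_plus_scaled_le\<close> compares with
  an integrable function not depending on \<open>L\<close>; the factor \<open>exp C\<close> absorbs
  the expansion error.\<close>

lemma saddle_integrand_bound:
  "\<forall>\<^sub>F L in at_top. \<forall>s. norm (saddle_integrand \<epsilon> L s) \<le> exp C * (1 / (1 + s\<^sup>2 / (4 * real (k + 1))))"
proof -
  obtain L0 :: real where L0: "L0 \<ge> 1"
    "\<And>L v \<phi> :: real. \<lbrakk>L \<ge> L0; 1 \<le> v; v \<le> L; \<bar>\<phi>\<bar> \<le> 2; \<phi>\<^sup>2 \<le> 8 * (L - v)\<rbrakk> \<Longrightarrow>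
       Re (log_poly k c (Complex v (- \<phi>))) \<le> log_poly k c L - (L - v) * L ^ k / (2 * real (k + 1))"
    using Re_log_poly_decay[OF k] by metis
  have "\<forall>\<^sub>F L in at_top. exp (- L) < \<rho> / 2"
    using tendstoD[OF exp_neg_at_top, of "\<rho> / 2"] rho(1) by simp
  \<comment> \<open>\<open>exp (- L) < \<rho> / 2\<close> together with the indicator keeps the
    point in the disc of radius \<open>\<rho>\<close>; \<open>L \<ge> 4 * (k + 1)\<close> makes the
    decay exponent \<open>L ^ k / (4 * (k + 1))\<close> at least 1.\<close>
  then show ?thesis using eventually_ge_at_top[of L0] eventually_ge_at_top[of "4 * real (k + 1)"]
  proof eventually_elim
    case (elim L)
    have L1: "L \<ge> 1" using elim L0(1) by linarith
    show ?case
    proof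
      fix s :: real
      define w where "w = saddle_point L s"
      define u where "u = saddle_width L * s"
      show "norm (saddle_integrand \<epsilon> L s) \<le> exp C * (1 / (1 + s\<^sup>2 / (4 * real (k + 1))))"
      proof (cases "\<bar>exp (- L) * u\<bar> \<le> \<rho> / 2")
        case False
        then have "saddle_integrand \<epsilon> L s = 0" by (simp add: saddle_integrand_def u_def mult.assoc)
        then show ?thesis by (simp add: add_nonneg_nonneg)
      next
        case True
        have "norm w \<le> \<bar>Re w\<bar> + \<bar>Im w\<bar>" by (rule cmod_le)
        also have "\<dots> \<le> \<rho>" using True elim by (simp add: w_def u_def)
        finally have w: "norm w \<le> \<rho>" .
        define v where "v = L - ln (1 + u\<^sup>2) / 2"
        have Lnw: "- Ln w = Complex v (- arctan u)"
          unfolding w_def Ln_saddle_point u_def[symmetric] Ln_one_plus_ii_times v_def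
          by (simp add: complex_eq_iff)
        have w0: "w \<noteq> 0" by (simp add: w_def)
        have "ln (norm w) \<le> ln (exp (-1))" using w rho w0 by (intro ln_mono) auto
        moreover have "Re (- Ln w) = - ln (norm w)" using w0 by simp
        ultimately have v1: "v \<ge> 1" unfolding Lnw by simp
        have vL: "v \<le> L" by (simp add: v_def)
        have at: "\<bar>arctan u\<bar> \<le> 2" using arctan_bounded[of u] pi_less_4 by auto
        have at2: "(arctan u)\<^sup>2 \<le> 8 * (L - v)" using arctan_squared_le[of u] by (simp add: v_def)
        have "Re (log_poly k c (- Ln w)) \<le> log_poly k c L - (L - v) * L ^ k / (2 * real (k + 1))"
          unfolding Lnw by (rule L0(2)[OF _ v1 vL at at2]) (use elim in simp)
        moreover have "Re (G (exp (- w))) - Re (log_poly k c (- Ln w)) \<le> C"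
        proof -
          have "Re (G (exp (- w)) - log_poly k c (- Ln w)) \<le> C * norm w"
            by (rule order_trans[OF complex_Re_le_cmod near[OF _ w0 w]]) (simp add: w_def)
          also have "\<dots> \<le> C * 1" using w rho C by (intro mult_left_mono) (auto intro: order_trans)
          finally show ?thesis by simp
        qed
        ultimately have "Re (G (exp (- w))) - log_poly k c L \<le> C - (L - v) * L ^ k / (2 * real (k + 1))" by simp
        also have "(L - v) * L ^ k / (2 * real (k + 1)) = L ^ k / (4 * real (k + 1)) * ln (1 + s\<^sup>2 / L ^ k)"
          using L1 by (simp add: v_def u_def power_mult_distrib saddle_width_squared)
        also have "C - \<dots> \<le> C - ln (1 + s\<^sup>2 / (4 * real (k + 1)))"
        proof -
          have "L \<le> L ^ k" using L1 k by (metis power_increasing power_one_right)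
          then have "L ^ k / (4 * real (k + 1)) \<ge> 1" using elim by (simp add: field_simps)
          then have "ln (1 + L ^ k / (4 * real (k + 1)) * (s\<^sup>2 / L ^ k)) \<le> L ^ k / (4 * real (k + 1)) * ln (1 + s\<^sup>2 / L ^ k)"
            using L1 by (intro ln_one_plus_scaled_le) auto
          moreover have "L ^ k / (4 * real (k + 1)) * (s\<^sup>2 / L ^ k) = s\<^sup>2 / (4 * real (k + 1))" using L1 by simp
          ultimately show ?thesis by simp
        qed
        finally have "exp (Re (G (exp (- w))) - log_poly k c L) \<le> exp (C - ln (1 + s\<^sup>2 / (4 * real (k + 1))))" by simp
        also have "\<dots> = exp C * (1 / (1 + s\<^sup>2 / (4 * real (k + 1))))"
          by (simp add: exp_diff add_pos_nonneg)
        finally show ?thesis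
          by (simp add: saddle_integrand_def w_def[symmetric] norm_mult indicator_def)
      qed
    qed
  qed
qed

end

section \<open>The Fourier integral over a full circle\<close>

lemma integrable_cauchy_density:
  assumes "a > 0"
  shows "integrable lborel (\<lambda>s::real. 1 / (1 + s\<^sup>2 / a))"
proof -
  have "integrable lborel (\<lambda>x::real. inverse (1 + x\<^sup>2))"
    using integrable_inverse_1_plus_square by (simp add: set_integrable_def einterval_def)
  then have "integrable lborel (\<lambda>x::real. inverse (1 + (0 + (1 / sqrt a) * x)\<^sup>2))"
    using assms by (subst lborel_integrable_real_affine_iff) auto
  then show ?thesis using assms by (simp add: power_mult_distrib power_divide inverse_eq_divide)
qed

lemma integral_gaussian: "(LINT s|lborel. complex_of_real (exp (- s\<^sup>2 / 2))) = of_real (sqrt (2 * pi))"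
proof -
  have "(LINT s|lborel. normal_density 0 1 s) = 1" by (rule integral_normal_density) simp
  moreover have "exp (- s\<^sup>2 / 2) = sqrt (2 * pi) * normal_density 0 1 s" for s :: real
    by (simp add: normal_density_def)
  ultimately have "(LINT s|lborel. exp (- s\<^sup>2 / 2)) = sqrt (2 * pi)"
    by (simp only: integral_mult_right_zero mult_1_right)
  then show ?thesis by (simp only: integral_complex_of_real)
qed

context log_singularity
begin

lemma saddle_integrand_measurable [measurable]: "saddle_integrand \<epsilon> L \<in> borel_measurable lborel"
proof -
  have "continuous_on UNIV (\<lambda>s. exp (- saddle_point L s))"
    unfolding saddle_point_def by (intro continuous_intros)
  then have "continuous_on UNIV (\<lambda>s. G (exp (- saddle_point L s)))"
    by (rule continuous_on_compose2[OF cont]) (auto intro!: exp_minus_mem simp del: Diff_iff)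
  then have [measurable]: "(\<lambda>s. G (exp (- saddle_point L s))) \<in> borel_measurable borel"
    by (rule borel_measurable_continuous_onI)
  have [measurable]: "{y::real. \<bar>y\<bar> \<le> \<rho> / 2} \<in> sets borel" by measurable
  show ?thesis unfolding saddle_integrand_def by measurable
qed

lemma saddle_integral_tendsto:
  "((\<lambda>L. LINT s|lborel. saddle_integrand \<epsilon> L s) \<longlongrightarrow> of_real (sqrt (2 * pi))) at_top"
  unfolding integral_gaussian[symmetric]
proof (rule integral_dominated_convergence_at_top[where w = "\<lambda>s. exp C * (1 / (1 + s\<^sup>2 / (4 * real (k + 1))))"])
  show "integrable lborel (\<lambda>s. exp C * (1 / (1 + s\<^sup>2 / (4 * real (k + 1)))))"
    by (intro integrable_mult_right integrable_cauchy_density) simp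
  show "AE s in lborel. ((\<lambda>L. saddle_integrand \<epsilon> L s) \<longlongrightarrow> complex_of_real (exp (- s\<^sup>2 / 2))) at_top"
    by (intro always_eventually allI saddle_integrand_tendsto)
  show "\<forall>\<^sub>F L in at_top. AE s in lborel. norm (saddle_integrand \<epsilon> L s) \<le> exp C * (1 / (1 + s\<^sup>2 / (4 * real (k + 1))))"
    using saddle_integrand_bound[of \<epsilon>] by eventually_elim auto
qed auto

text \<open>The Jacobian \<open>exp (- L) * saddle_width L\<close> of the substitution from the
  angle to \<open>s\<close>, times the peak value \<open>exp (log_poly k c L)\<close>.\<close>

definition saddle_scale :: "real \<Rightarrow> real" where
  "saddle_scale L = exp (- L) * saddle_width L * exp (log_poly k c L)"

lemma saddle_scale_pos: "L > 0 \<Longrightarrow> saddle_scale L > 0"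
  by (simp add: saddle_scale_def saddle_width_def)

lemma inverse_saddle_scale_tendsto: "((\<lambda>L. 1 / saddle_scale L) \<longlongrightarrow> 0) at_top"
proof (rule Lim_null_comparison)
  show "((\<lambda>L. exp (- (log_poly k c L - (real k + 1) * L))) \<longlongrightarrow> 0) at_top"
    by (rule filterlim_compose[OF exp_neg_at_top log_poly_superlinear[OF k]])
  show "\<forall>\<^sub>F L in at_top. norm (1 / saddle_scale L) \<le> exp (- (log_poly k c L - (real k + 1) * L))"
  proof (rule eventually_mono[OF eventually_ge_at_top[of 1]])
    fix L :: real assume L: "L \<ge> 1"
    have "sqrt (L ^ k) \<le> L ^ k" using L by (intro real_le_lsqrt) (auto simp: power2_eq_square)
    also have "\<dots> \<le> exp L ^ k" by (intro power_mono; use L exp_ge_add_one_self[of L] in linarith)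
    also have "\<dots> = exp (real k * L)" by (simp add: exp_of_nat_mult)
    finally have *: "sqrt (L ^ k) \<le> exp (real k * L)" .
    have "norm (1 / saddle_scale L) = sqrt (L ^ k) * exp (L - log_poly k c L)"
      using L by (simp add: saddle_scale_def saddle_width_def exp_minus exp_diff field_simps)
    also have "\<dots> \<le> exp (real k * L) * exp (L - log_poly k c L)"
      using * by (rule mult_right_mono) simp
    also have "\<dots> = exp (- (log_poly k c L - (real k + 1) * L))"
      by (simp add: mult_exp_exp algebra_simps)
    finally show "norm (1 / saddle_scale L) \<le> exp (- (log_poly k c L - (real k + 1) * L))" .
  qed
qed

text \<open>Compactness: the rectangle is closed and includes \<open>Re w = 0\<close>, so the bound
  stays uniform as the circles approach the unit circle. This is where continuity of
  \<open>G\<close> up to the boundary enters.\<close>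

lemma bounded_away_from_singularity:
  obtains M where "\<And>x y. 0 \<le> x \<Longrightarrow> x \<le> 1 \<Longrightarrow> \<rho> / 2 \<le> \<bar>y\<bar> \<Longrightarrow> \<bar>y\<bar> \<le> pi \<Longrightarrow> norm (exp (G (exp (- Complex x y)))) \<le> M"
proof -
  define K where "K = cbox (Complex 0 (- pi)) (Complex 1 pi) \<inter> {w. \<rho> / 2 \<le> \<bar>Im w\<bar>}"
  have "closed {w. \<rho> / 2 \<le> \<bar>Im w\<bar>}" by (intro closed_Collect_le continuous_intros)
  then have "compact K" unfolding K_def by (intro compact_Int_closed compact_cbox)
  moreover have "continuous_on K (\<lambda>w. exp (G (exp (- w))))"
  proof (intro continuous_on_exp continuous_on_compose2[OF cont] continuous_intros)
    show "(\<lambda>w. exp (- w)) ` K \<subseteq> cball 0 1 - {1}"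
    proof clarify
      fix w assume w: "w \<in> K"
      have "exp (- w) \<noteq> 1"
      proof
        assume "exp (- w) = 1"
        then obtain n :: int where n: "Im (- w) = of_int (2 * n) * pi" unfolding exp_eq_1 by auto
        have "\<bar>Im w\<bar> \<le> pi" "\<bar>Im w\<bar> > 0" using w rho by (auto simp: K_def in_cbox_complex_iff)
        have "Im w = - (of_int (2 * n) * pi)" using n by simp
        then have "\<bar>Im w\<bar> = \<bar>of_int (2 * n)\<bar> * pi" by (simp only: abs_minus_cancel abs_mult) simp
        then have "\<bar>real_of_int (2 * n)\<bar> * pi \<le> 1 * pi" "n \<noteq> 0" using \<open>\<bar>Im w\<bar> \<le> pi\<close> \<open>\<bar>Im w\<bar> > 0\<close> by auto
        then have "\<bar>real_of_int (2 * n)\<bar> \<le> 1" using mult_right_le_imp_le[of "\<bar>real_of_int (2 * n)\<bar>" pi 1] by simp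
        then show False using \<open>n \<noteq> 0\<close> by linarith
      qed
      then show "exp (- w) \<in> cball 0 1 - {1}"
        using w by (auto simp: K_def in_cbox_complex_iff)
    qed
  qed
  ultimately have "bounded ((\<lambda>w. exp (G (exp (- w)))) ` K)"
    by (intro compact_imp_bounded compact_continuous_image)
  then obtain M where M: "\<And>w. w \<in> K \<Longrightarrow> norm (exp (G (exp (- w)))) \<le> M" by (auto simp: bounded_iff)
  show thesis
    by (rule that[of M], rule M) (auto simp: K_def in_cbox_complex_iff)
qed

text \<open>On the arc around 1 the integral is exactly \<open>saddle_scale L\<close> times the
  rescaled integral. The rest is bounded by a constant, hence negligible after division by the
  scale. \<open>L\<close> varies continuously, so the frequency need not be an integer here.\<close>

lemma fourier_integral_asymp:
  "((\<lambda>L. (LINT y:{-pi..pi}|lborel. exp (G (exp (- Complex (exp (- L)) y)) 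
            + \<i> * of_real ((log_poly_deriv k c L * exp L - \<epsilon>) * y))) / of_real (saddle_scale L))
     \<longlongrightarrow> of_real (sqrt (2 * pi))) at_top"
proof -
  define f where "f L y = exp (G (exp (- Complex (exp (- L)) y)) 
            + \<i> * of_real ((log_poly_deriv k c L * exp L - \<epsilon>) * y))" for L y
  have f_cont: "continuous_on UNIV (f L)" for L
  proof -
    have "continuous_on UNIV (\<lambda>y. exp (- Complex (exp (- L)) y))"
      unfolding Complex_eq by (intro continuous_intros)
    then have "continuous_on UNIV (\<lambda>y. G (exp (- Complex (exp (- L)) y)))"
      by (rule continuous_on_compose2[OF cont]) (auto intro!: exp_minus_mem simp del: Diff_iff)
    then show ?thesis unfolding f_def by (intro continuous_intros)
  qed
  then have [measurable]: "f L \<in> borel_measurable borel" for L by (intro borel_measurable_continuous_onI)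
  have f_int: "set_integrable lborel {-pi..pi} (f L)" for L
    by (rule borel_integrable_atLeastAtMost') (rule continuous_on_subset[OF f_cont], simp)
  define A where "A = {y::real. \<bar>y\<bar> \<le> \<rho> / 2}"
  define B where "B = {-pi..pi} - A"
  have [measurable]: "A \<in> sets borel" "B \<in> sets borel" unfolding A_def B_def by measurable
  have rho1: "\<rho> \<le> 1" using rho by (auto intro: order_trans)
  have A_sub: "A \<subseteq> {-pi..pi}" using rho1 pi_gt3 by (auto simp: A_def abs_le_iff)
  have near_part: "(LINT y:A|lborel. f L y) = of_real (saddle_scale L) * (LINT s|lborel. saddle_integrand \<epsilon> L s)"
    if L: "L > 0" for L
  proof -
    define h where "h = exp (- L) * saddle_width L"
    have h: "h > 0" using L by (simp add: h_def saddle_width_def)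
    have "(LINT y:A|lborel. f L y) = \<bar>h\<bar> *\<^sub>R (LINT s|lborel. indicator A (0 + h * s) *\<^sub>R f L (0 + h * s))"
      unfolding set_lebesgue_integral_def by (rule lborel_integral_real_affine) (use h in auto)
    also have "(\<lambda>s. indicator A (0 + h * s) *\<^sub>R f L (0 + h * s)) = (\<lambda>s. of_real (exp (log_poly k c L)) * saddle_integrand \<epsilon> L s)"
    proof
      fix s
      have "Complex (exp (- L)) (h * s) = saddle_point L s" by (simp add: complex_eq_iff h_def mult.assoc)
      moreover have "(log_poly_deriv k c L * exp L - \<epsilon>) * (h * s) = (log_poly_deriv k c L - \<epsilon> * exp (- L)) * (saddle_width L * s)"
        by (simp add: h_def exp_minus field_simps)
      moreover have "exp (g + z) = of_real (exp p) * exp (g - of_real p + z)" for g z :: complex and p :: real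
        by (simp add: exp_of_real[symmetric] mult_exp_exp)
      ultimately have "f L (h * s) = of_real (exp (log_poly k c L)) * exp (G (exp (- saddle_point L s)) - of_real (log_poly k c L)
          + \<i> * of_real ((log_poly_deriv k c L - \<epsilon> * exp (- L)) * (saddle_width L * s)))"
        unfolding f_def by (simp only:)
      then show "indicator A (0 + h * s) *\<^sub>R f L (0 + h * s) = of_real (exp (log_poly k c L)) * saddle_integrand \<epsilon> L s"
        by (simp add: saddle_integrand_def A_def h_def indicator_def)
    qed
    finally show ?thesis using h
      by (simp add: scaleR_conv_of_real saddle_scale_def h_def)
  qed
  obtain M where M: "\<And>x y. 0 \<le> x \<Longrightarrow> x \<le> 1 \<Longrightarrow> \<rho> / 2 \<le> \<bar>y\<bar> \<Longrightarrow> \<bar>y\<bar> \<le> pi \<Longrightarrow> norm (exp (G (exp (- Complex x y)))) \<le> M"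
    using bounded_away_from_singularity by blast
  have far_part: "norm (LINT y:B|lborel. f L y) \<le> 2 * pi * M" if L: "L > 0" for L
  proof -
    have "norm (LINT y:B|lborel. f L y) \<le> (LINT y|lborel. indicator {-pi..pi} y * M)"
      unfolding set_lebesgue_integral_def
    proof (rule Bochner_Integration.integral_norm_bound_integral)
      show "integrable lborel (\<lambda>y. indicator B y *\<^sub>R f L y)"
        using set_integrable_subset[OF f_int, of B] by (simp add: B_def set_integrable_def)
      show "integrable lborel (\<lambda>y. indicator {-pi..pi} y * M)" by simp
      fix y :: real
      have "M \<ge> 0" by (rule order_trans[OF norm_ge_zero M[of 0 pi]]) (use rho1 pi_gt3 in auto)
      have "norm (f L y) \<le> M" if "y \<in> B"
      proof -
        have "norm (f L y) = norm (exp (G (exp (- Complex (exp (- L)) y))))"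
          by (simp add: f_def)
        also have "\<dots> \<le> M" using that L by (intro M) (auto simp: B_def A_def abs_le_iff)
        finally show ?thesis .
      qed
      then show "norm (indicator B y *\<^sub>R f L y) \<le> indicator {-pi..pi} y * M"
        using \<open>M \<ge> 0\<close> by (auto simp: indicator_def B_def)
    qed
    also have "\<dots> = 2 * pi * M" by simp
    finally show ?thesis .
  qed
  have split: "(LINT y:{-pi..pi}|lborel. f L y) = (LINT y:A|lborel. f L y) + (LINT y:B|lborel. f L y)" for L
  proof -
    have "A \<union> B = {-pi..pi}" "A \<inter> B = {}" using A_sub by (auto simp: B_def)
    then show ?thesis
      using set_integral_Un[of A B lborel "f L"] set_integrable_subset[OF f_int, of A L] set_integrable_subset[OF f_int, of B L] A_sub
      by (auto simp: B_def)
  qed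
  have "((\<lambda>L. (LINT y:B|lborel. f L y) / of_real (saddle_scale L)) \<longlongrightarrow> 0) at_top"
  proof (rule Lim_null_comparison)
    show "((\<lambda>L. 2 * pi * M * (1 / saddle_scale L)) \<longlongrightarrow> 0) at_top"
      by (rule tendsto_mult_right_zero[OF inverse_saddle_scale_tendsto])
    show "\<forall>\<^sub>F L in at_top. norm ((LINT y:B|lborel. f L y) / of_real (saddle_scale L)) \<le> 2 * pi * M * (1 / saddle_scale L)"
    proof (rule eventually_mono[OF eventually_gt_at_top[of 0]])
      fix L :: real assume L: "L > 0"
      show "norm ((LINT y:B|lborel. f L y) / of_real (saddle_scale L)) \<le> 2 * pi * M * (1 / saddle_scale L)"
        using far_part[OF L] saddle_scale_pos[OF L] by (simp add: norm_divide divide_right_mono)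
    qed
  qed
  from tendsto_add[OF saddle_integral_tendsto[of \<epsilon>] this]
  have "((\<lambda>L. (LINT s|lborel. saddle_integrand \<epsilon> L s) + (LINT y:B|lborel. f L y) / of_real (saddle_scale L))
      \<longlongrightarrow> of_real (sqrt (2 * pi))) at_top" by simp
  moreover have "\<forall>\<^sub>F L in at_top. (LINT s|lborel. saddle_integrand \<epsilon> L s) + (LINT y:B|lborel. f L y) / of_real (saddle_scale L)
      = (LINT y:{-pi..pi}|lborel. f L y) / of_real (saddle_scale L)"
  proof (rule eventually_mono[OF eventually_gt_at_top[of 0]])
    fix L :: real assume L: "L > 0"
    show "(LINT s|lborel. saddle_integrand \<epsilon> L s) + (LINT y:B|lborel. f L y) / of_real (saddle_scale L)
      = (LINT y:{-pi..pi}|lborel. f L y) / of_real (saddle_scale L)"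
      unfolding split near_part[OF L] using saddle_scale_pos[OF L] by (simp add: add_divide_distrib)
  qed
  ultimately show ?thesis unfolding f_def[symmetric] by (rule Lim_transform_eventually)
qed

end

subsection \<open>Ratios of coefficients\<close>

lemma integral_exp_ii_int:
  fixes j :: int
  shows "(LINT y:{-pi..pi}|lborel. exp (\<i> * of_real (real_of_int j * y))) = (if j = 0 then of_real (2 * pi) else 0)"
proof (cases "j = 0")
  case True
  then show ?thesis by (simp add: set_lebesgue_integral_def scaleR_conv_of_real)
next
  case False
  have "((\<lambda>y. exp (\<i> * of_real (of_int j * y))) has_integral
      exp (\<i> * of_real (of_int j * pi)) / (\<i> * of_int j) - exp (\<i> * of_real (of_int j * (- pi))) / (\<i> * of_int j)) {-pi..pi}"
  proof (rule fundamental_theorem_of_calculus)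
    fix y :: real
    have "((\<lambda>z. exp (\<i> * (of_int j * z)) / (\<i> * of_int j)) has_field_derivative exp (\<i> * (of_int j * of_real y))) (at (of_real y))"
      using False by (auto intro!: derivative_eq_intros simp: mult.left_commute[of _ \<i>] mult.commute[of _ \<i>])
    from has_vector_derivative_real_field[OF this]
    show "((\<lambda>y. exp (\<i> * of_real (of_int j * y)) / (\<i> * of_int j)) has_vector_derivative exp (\<i> * of_real (of_int j * y))) (at y within {-pi..pi})"
      by simp
  qed simp
  moreover have "exp (\<i> * of_real (of_int j * pi)) = exp (\<i> * of_real (of_int j * (- pi)))"
    unfolding exp_eq by (intro exI[of _ j]) simp
  ultimately have "((\<lambda>y. exp (\<i> * of_real (of_int j * y))) has_integral 0) {-pi..pi}"
    by simp
  moreover have "set_integrable lborel {-pi..pi} (\<lambda>y. exp (\<i> * of_real (of_int j * y)))"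
    by (intro borel_integrable_atLeastAtMost' continuous_intros)
  ultimately show ?thesis
    using False by (simp add: set_borel_integral_eq_integral(2) integral_unique)
qed

text \<open>Cauchy's coefficient formula, obtained by termwise integration and orthogonality so that
  it appears directly as the Lebesgue integral of the saddle point estimate.\<close>

lemma fourier_coefficient_power_series:
  assumes sums: "\<And>t. norm t < 1 \<Longrightarrow> (\<lambda>n. H n * t ^ n) sums f t" and x: "x > 0"
  shows "(LINT y:{-pi..pi}|lborel. f (exp (- Complex x y)) * exp (\<i> * of_real (real n * y)))
           = of_real (2 * pi) * (H n * of_real (exp (- real n * x)))"
proof -
  define h where "h m y = H m * of_real (exp (- real m * x)) * exp (\<i> * of_real (real_of_int (int n - int m) * y))" for m y
  have term_eq: "H m * exp (- Complex x y) ^ m * exp (\<i> * of_real (real n * y)) = h m y" for m y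
  proof -
    have "exp (- Complex x y) ^ m * exp (\<i> * of_real (real n * y)) = 
       exp (of_real (- real m * x) + \<i> * of_real (real_of_int (int n - int m) * y))"
      unfolding exp_of_nat_mult[symmetric] mult_exp_exp
      by (rule arg_cong[where f = exp]) (simp add: complex_eq_iff algebra_simps)
    also have "\<dots> = of_real (exp (- real m * x)) * exp (\<i> * of_real (real_of_int (int n - int m) * y))"
      by (simp only: exp_add exp_of_real)
    finally show ?thesis by (simp add: h_def mult.assoc)
  qed
  have h_int: "set_integrable lborel {-pi..pi} (h m)" for m
    unfolding h_def by (intro borel_integrable_atLeastAtMost' continuous_intros)
  have norm_h: "norm (h m y) = norm (H m) * exp (- real m * x)" for m y
    by (simp add: h_def norm_mult)
  have summ: "summable (\<lambda>m. norm (H m) * exp (- real m * x))"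
  proof -
    \<comment> \<open>A radius strictly between \<open>exp (- x)\<close> and 1: convergence there
      gives absolute convergence on the smaller circle.\<close>
    have "summable (\<lambda>m. H m * of_real (exp (- x / 2)) ^ m)"
      using sums[of "of_real (exp (- x / 2))"] x by (auto simp: sums_iff)
    from powser_insidea[OF this, of "of_real (exp (- x))"] have "summable (\<lambda>m. norm (H m * of_real (exp (- x)) ^ m))"
      using x by simp
    moreover have "exp (- x) ^ m = exp (- real m * x)" for m by (simp add: exp_of_nat_mult[symmetric])
    ultimately show ?thesis by (simp add: norm_mult norm_power)
  qed
  have h_sums: "(\<lambda>m. h m y) sums (f (exp (- Complex x y)) * exp (\<i> * of_real (real n * y)))" for y
  proof -
    have "norm (exp (- Complex x y)) < 1" using x by simp
    from sums_mult2[OF sums[OF this], of "exp (\<i> * of_real (real n * y))"] show ?thesis by (simp only: term_eq)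
  qed
  have "(\<lambda>m. LINT y|lborel. indicator {-pi..pi} y *\<^sub>R h m y) sums (LINT y|lborel. (\<Sum>m. indicator {-pi..pi} y *\<^sub>R h m y))"
  proof (rule sums_integral)
    show "integrable lborel (\<lambda>y. indicator {-pi..pi} y *\<^sub>R h m y)" for m
      using h_int by (simp add: set_integrable_def)
    show "AE y in lborel. summable (\<lambda>m. norm (indicator {-pi..pi} y *\<^sub>R h m y))"
      by (rule AE_I2) (use summ in \<open>simp add: norm_h\<close>)
    have "(LINT y|lborel. norm (indicator {-pi..pi} y *\<^sub>R h m y)) = 2 * pi * (norm (H m) * exp (- real m * x))" for m
    proof -
      have "(LINT y|lborel. norm (indicator {-pi..pi} y *\<^sub>R h m y)) = (LINT y|lborel. indicator {-pi..pi} y * (norm (H m) * exp (- real m * x)))"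
        by (simp add: norm_h)
      then show ?thesis by simp
    qed
    then show "summable (\<lambda>m. LINT y|lborel. norm (indicator {-pi..pi} y *\<^sub>R h m y))"
      using summable_mult[OF summ, of "2 * pi"] by simp
  qed
  moreover have "(LINT y|lborel. (\<Sum>m. indicator {-pi..pi} y *\<^sub>R h m y)) =
      (LINT y:{-pi..pi}|lborel. f (exp (- Complex x y)) * exp (\<i> * of_real (real n * y)))"
    unfolding set_lebesgue_integral_def
    by (intro Bochner_Integration.integral_cong refl) (auto simp: indicator_def sums_unique[OF h_sums, symmetric])
  moreover have "(LINT y|lborel. indicator {-pi..pi} y *\<^sub>R h m y) = (if m = n then of_real (2 * pi) * (H n * of_real (exp (- real n * x))) else 0)" for m
  proof -
    have "(LINT y:{-pi..pi}|lborel. h m y) = H m * of_real (exp (- real m * x)) * (LINT y:{-pi..pi}|lborel. exp (\<i> * of_real (real_of_int (int n - int m) * y)))"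
      unfolding h_def by (rule set_integral_mult_right)
    also have "\<dots> = (if m = n then of_real (2 * pi) * (H n * of_real (exp (- real n * x))) else 0)"
      unfolding integral_exp_ii_int by auto
    finally show ?thesis by (simp only: set_lebesgue_integral_def)
  qed
  ultimately have "(\<lambda>m. if m = n then of_real (2 * pi) * (H n * of_real (exp (- real n * x))) else 0) sums
     (LINT y:{-pi..pi}|lborel. f (exp (- Complex x y)) * exp (\<i> * of_real (real n * y)))" by simp
  then show ?thesis
    by (rule sums_unique2[OF _ sums_single[of n "\<lambda>_. of_real (2 * pi) * (H n * of_real (exp (- real n * x)))"]])
qed

text \<open>\<open>g\<close> may oscillate at first, so there is no inverse function to use.
  Solutions exist by the intermediate value theorem once \<open>real n \<ge> g 0\<close>; they tend
  to infinity because \<open>g\<close> is bounded on each \<open>{0..Z}\<close>.\<close>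

lemma real_solution_sequence:
  fixes g :: "real \<Rightarrow> real"
  assumes cont: "continuous_on UNIV g" and lim: "filterlim g at_top at_top"
  obtains X where "filterlim X at_top sequentially" "\<forall>\<^sub>F n in sequentially. g (X n) = real n"
proof -
  have ex: "\<exists>x\<ge>0. g x = real n" if n: "real n \<ge> g 0" for n
  proof -
    have "\<forall>\<^sub>F x in at_top. g x \<ge> real n \<and> x \<ge> 0"
      using lim eventually_ge_at_top[of 0] by (auto simp: filterlim_at_top intro: eventually_conj)
    then obtain z where z: "g z \<ge> real n" "z \<ge> 0" using eventually_happens'[OF trivial_limit_at_top_linorder] by blast
    have "continuous_on {0..z} g" by (rule continuous_on_subset[OF cont]) simp
    then show ?thesis using IVT'[of g 0 "real n" z] n z by auto
  qed
  define X where "X n = (SOME x. x \<ge> 0 \<and> g x = real n)" for n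
  have X: "X n \<ge> 0 \<and> g (X n) = real n" if "real n \<ge> g 0" for n
    unfolding X_def by (rule someI_ex) (use ex[OF that] in blast)
  have ev: "\<forall>\<^sub>F n in sequentially. real n \<ge> a" for a
    using filterlim_real_sequentially by (auto simp: filterlim_at_top)
  show thesis
  proof (rule that[of X])
    show "\<forall>\<^sub>F n in sequentially. g (X n) = real n"
      using ev[of "g 0"] by eventually_elim (use X in auto)
    show "filterlim X at_top sequentially"
      unfolding filterlim_at_top
    proof
      fix Z :: real
      have "continuous_on {0..Z} g" by (rule continuous_on_subset[OF cont]) simp
      then have "bounded (g ` {0..Z})" by (intro compact_imp_bounded compact_continuous_image) auto
      then obtain M where M: "\<forall>x\<in>{0..Z}. \<bar>g x\<bar> \<le> M" by (auto simp: bounded_iff)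
      show "\<forall>\<^sub>F n in sequentially. Z \<le> X n"
        using ev[of "g 0"] ev[of "M + 1"]
      proof eventually_elim
        case (elim n)
        show ?case
        proof (rule ccontr)
          assume "\<not> Z \<le> X n"
          then have "X n \<in> {0..Z}" using X[of n] elim by auto
          then show False using bspec[OF M, of "X n"] X[of n] elim by auto
        qed
      qed
    qed
  qed
qed

context log_singularity
begin

text \<open>Taking \<open>\<epsilon>\<close> as 0 and as 1 at the same \<open>L n\<close> gives the
  coefficients \<open>n\<close> and \<open>n - 1\<close> with a common scale, which drops out of the
  quotient. The limit \<open>sqrt (2 * pi)\<close> is nonzero, so the coefficients are eventually
  nonzero as well.\<close>

theorem coefficient_ratio:
  assumes sums: "\<And>t. norm t < 1 \<Longrightarrow> (\<lambda>n. H n * t ^ n) sums exp (G t)"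
  shows "\<forall>\<^sub>F n in sequentially. H n \<noteq> 0" "(\<lambda>n. H n / H (Suc n)) \<longlonglongrightarrow> 1"
proof -
  have deriv_top: "filterlim (\<lambda>L::real. log_poly_deriv k c L) at_top at_top"
  proof -
    have "filterlim (\<lambda>L::real. log_poly_deriv k c L / L ^ k * L ^ k) at_top at_top"
      by (rule filterlim_tendsto_pos_mult_at_top[OF log_poly_deriv_asymp[OF k]])
         (use k in \<open>auto intro!: filterlim_pow_at_top filterlim_ident\<close>)
    moreover have "\<forall>\<^sub>F L::real in at_top. log_poly_deriv k c L / L ^ k * L ^ k = log_poly_deriv k c L"
      by (rule eventually_mono[OF eventually_gt_at_top[of 0]]) auto
    ultimately show ?thesis by (simp add: filterlim_cong)
  qed
  have "filterlim (\<lambda>L::real. log_poly_deriv k c L * exp L) at_top at_top"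
    by (rule filterlim_at_top_mult_at_top[OF deriv_top exp_at_top])
  moreover have "continuous_on UNIV (\<lambda>L::real. log_poly_deriv k c L * exp L)"
    unfolding log_poly_deriv_def by (intro continuous_intros)
  ultimately obtain L where L: "filterlim L at_top sequentially" 
    and Ln: "\<forall>\<^sub>F n in sequentially. log_poly_deriv k c (L n) * exp (L n) = real n"
    using real_solution_sequence by blast
  define K where "K \<epsilon> n = (LINT y:{-pi..pi}|lborel. exp (G (exp (- Complex (exp (- L n)) y)) 
            + \<i> * of_real ((log_poly_deriv k c (L n) * exp (L n) - \<epsilon>) * y))) / of_real (saddle_scale (L n))" for \<epsilon> n
  have K: "K \<epsilon> \<longlonglongrightarrow> of_real (sqrt (2 * pi))" for \<epsilon>
    unfolding K_def by (rule filterlim_compose[OF fourier_integral_asymp L])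
  have K_eq: "K \<epsilon> n = of_real (2 * pi) * (H m * of_real (exp (- real m * exp (- L n)))) / of_real (saddle_scale (L n))"
    if "log_poly_deriv k c (L n) * exp (L n) = real n" "real m = real n - \<epsilon>" for n m \<epsilon>
    using fourier_coefficient_power_series[OF sums, of "exp (- L n)" m] that
    by (simp add: K_def exp_add)
  have K0_nz: "\<forall>\<^sub>F n in sequentially. K 0 n \<noteq> 0"
    by (rule tendsto_imp_eventually_ne[OF K]) simp
  show nz: "\<forall>\<^sub>F n in sequentially. H n \<noteq> 0"
    using K0_nz Ln by eventually_elim (auto simp: K_eq)
  \<comment> \<open>The two coefficients carry powers of the radius \<open>exp (- x)\<close>,
    \<open>x = exp (- L n)\<close>, that differ by one; the added factor \<open>exp (- x)\<close>
    compensates this and tends to 1.\<close>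
  have "(\<lambda>n. K 1 n / K 0 n * of_real (exp (- exp (- L n)))) \<longlonglongrightarrow> of_real (sqrt (2 * pi)) / of_real (sqrt (2 * pi)) * of_real (exp (- 0))"
    by (intro tendsto_intros K filterlim_compose[OF exp_neg_at_top L]) simp
  moreover have "\<forall>\<^sub>F n in sequentially. K 1 n / K 0 n * of_real (exp (- exp (- L n))) = H (n - 1) / H n"
    using K0_nz Ln eventually_ge_at_top[of 1] filterlim_at_top_dense[THEN iffD1, OF L, rule_format, of 0]
  proof eventually_elim
    case (elim n)
    define x where "x = exp (- L n)"
    have s: "saddle_scale (L n) \<noteq> 0" using saddle_scale_pos[OF elim(4)] by simp
    have "H n \<noteq> 0" using elim K_eq[of n n 0] by auto
    have e: "exp (- real (n - 1) * x) * exp (- x) = exp (- real n * x)"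
      using elim by (simp add: mult_exp_exp of_nat_diff algebra_simps)
    have "K 1 n / K 0 n * of_real (exp (- x)) = H (n - 1) * of_real (exp (- real (n - 1) * x) * exp (- x)) / (H n * of_real (exp (- real n * x)))"
      using K_eq[of n "n - 1" 1] K_eq[of n n 0] elim s by (simp add: x_def[symmetric] of_nat_diff)
    also have "\<dots> = H (n - 1) / H n" unfolding e by simp
    finally show ?case by (simp add: x_def)
  qed
  ultimately have "(\<lambda>n. H (n - 1) / H n) \<longlonglongrightarrow> 1"
    using Lim_transform_eventually by force
  then show "(\<lambda>n. H n / H (Suc n)) \<longlonglongrightarrow> 1"
    using LIMSEQ_Suc by fastforce
qed

end

section \<open>Convolution with a rapidly decaying sequence\<close>

lemma ratio_limit_shift:
  fixes H :: "nat \<Rightarrow> complex"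
  assumes nz: "\<forall>\<^sub>F n in sequentially. H n \<noteq> 0" and ratio: "(\<lambda>n. H n / H (Suc n)) \<longlonglongrightarrow> 1"
  shows "(\<lambda>n. H (n - s) / H n) \<longlonglongrightarrow> 1"
proof (induction s)
  case 0
  have "\<forall>\<^sub>F n in sequentially. 1 = H (n - 0) / H n" using nz by eventually_elim simp
  then show ?case by (rule Lim_transform_eventually[OF tendsto_const])
next
  case (Suc s)
  have sub: "filterlim (\<lambda>n. n - j) sequentially sequentially" for j
    by (rule filterlim_minus_const_nat_at_top)
  have "(\<lambda>n. H (n - Suc s) / H (Suc (n - Suc s)) * (H (n - s) / H n)) \<longlonglongrightarrow> 1 * 1"
    by (intro tendsto_mult filterlim_compose[OF ratio sub] Suc)
  moreover have "\<forall>\<^sub>F n in sequentially. H (n - Suc s) / H (Suc (n - Suc s)) * (H (n - s) / H n) = H (n - Suc s) / H n"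
    using eventually_compose_filterlim[OF nz sub[of s]] eventually_gt_at_top[of s]
  proof eventually_elim
    case (elim n)
    then have "Suc (n - Suc s) = n - s" by simp
    then show ?case using elim by simp
  qed
  ultimately show ?case using Lim_transform_eventually by force
qed

text \<open>Since the ratios tend to 1 they are eventually below 2, so
  \<open>H (n - i) / H n\<close> is at most a constant times \<open>2 ^ i\<close>; the weight in the
  summability hypothesis is there to dominate it.\<close>

lemma convolution_ratio:
  fixes H q :: "nat \<Rightarrow> complex"
  assumes nz: "\<forall>\<^sub>F n in sequentially. H n \<noteq> 0" and ratio: "(\<lambda>n. H n / H (Suc n)) \<longlonglongrightarrow> 1"
    and q: "summable (\<lambda>i. norm (q i) * 2 ^ i)"
  shows "(\<lambda>n. (\<Sum>i\<le>n. q i * H (n - i)) / H n) \<longlonglongrightarrow> (\<Sum>i. q i)"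
proof -
  have "\<forall>\<^sub>F n in sequentially. norm (H n / H (Suc n)) < 2"
    using order_tendstoD(2)[OF tendsto_norm[OF ratio], of 2] by simp
  then have "\<forall>\<^sub>F n in sequentially. H n \<noteq> 0 \<and> norm (H n / H (Suc n)) < 2"
    using nz by eventually_elim auto
  then obtain N where N: "\<And>n. n \<ge> N \<Longrightarrow> H n \<noteq> 0" "\<And>n. n \<ge> N \<Longrightarrow> norm (H n / H (Suc n)) < 2"
    unfolding eventually_sequentially by blast
  have step: "norm (H n) \<le> 2 * norm (H (Suc n))" if "n \<ge> N" for n
    using N(2)[OF that] N(1)[of "Suc n"] that by (simp add: norm_divide divide_less_eq)
  have grow: "norm (H m) \<le> 2 ^ j * norm (H (m + j))" if "m \<ge> N" for m j
  proof (induction j)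
    case (Suc j)
    have "norm (H m) \<le> 2 ^ j * norm (H (m + j))" by (rule Suc)
    also have "\<dots> \<le> 2 ^ j * (2 * norm (H (Suc (m + j))))"
      using step[of "m + j"] that by (intro mult_left_mono) auto
    finally show ?case by simp
  qed simp
  \<comment> \<open>\<open>D\<close> compares the finitely many coefficients before the ratio bound
    sets in with \<open>H N\<close>.\<close>
  define D where "D = (\<Sum>m\<le>N. norm (H m)) / norm (H N)"
  have HN: "norm (H N) > 0" using N(1)[of N] by simp
  have D: "norm (H m) \<le> D * norm (H N)" if "m \<le> N" for m
    using HN that member_le_sum[of m "{..N}" "\<lambda>m. norm (H m)"] by (simp add: D_def)
  have D0: "D \<ge> 0" unfolding D_def by (intro divide_nonneg_nonneg sum_nonneg) auto
  \<comment> \<open>Extension by 0 beyond \<open>n\<close> turns sums of growing length into series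
    over one index set.\<close>
  define a where "a i n = q i * (if i \<le> n then H (n - i) / H n else 0)" for i n
  have bound: "norm (a i n) \<le> (1 + D) * (norm (q i) * 2 ^ i)" if n: "n \<ge> N" for i n
  proof (cases "i \<le> n")
    case True
    have Hn: "norm (H n) > 0" using N(1)[OF n] by simp
    have "norm (H (n - i)) \<le> (1 + D) * 2 ^ i * norm (H n)"
    proof (cases "n - i \<ge> N")
      case ni: True
      have "norm (H (n - i)) \<le> 2 ^ i * norm (H n)" using grow[OF ni, of i] True by simp
      also have "\<dots> \<le> (1 + D) * (2 ^ i * norm (H n))" using D0 mult_right_mono[of 1 "1 + D" "2 ^ i * norm (H n)"] by simp
      finally show ?thesis by (simp add: mult.assoc)
    next
      case False
      then have "norm (H (n - i)) \<le> D * norm (H N)" by (intro D) simp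
      also have "\<dots> \<le> D * (2 ^ (n - N) * norm (H n))"
        using grow[of N "n - N"] n D0 by (intro mult_left_mono) auto
      \<comment> \<open>Here \<open>n - i < N\<close>, hence \<open>n - N \<le> i\<close>.\<close>
      also have "\<dots> \<le> D * (2 ^ i * norm (H n))"
        using False D0 by (intro mult_left_mono mult_right_mono power_increasing) auto
      also have "\<dots> \<le> (1 + D) * (2 ^ i * norm (H n))" by (intro mult_right_mono) auto
      finally show ?thesis by (simp add: mult.assoc)
    qed
    then have "norm (H (n - i) / H n) \<le> (1 + D) * 2 ^ i"
      using Hn by (simp add: norm_divide divide_le_eq)
    then have "norm (q i) * norm (H (n - i) / H n) \<le> norm (q i) * ((1 + D) * 2 ^ i)"
      by (rule mult_left_mono) simp
    then show ?thesis using True by (simp add: a_def norm_mult mult_ac times_divide_eq_right[symmetric] del: times_divide_eq_right)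
  next
    case False
    then show ?thesis using D0 by (simp add: a_def)
  qed
  have "((\<lambda>n. suminf (\<lambda>i. a i n)) \<longlongrightarrow> suminf q) sequentially"
  proof (rule tannerys_theorem[THEN conjunct2, THEN conjunct2])
    show "((\<lambda>n. a i n) \<longlongrightarrow> q i) sequentially" for i
    proof -
      have "(\<lambda>n. q i * (H (n - i) / H n)) \<longlonglongrightarrow> q i * 1"
        by (intro tendsto_mult tendsto_const ratio_limit_shift[OF nz ratio])
      moreover have "\<forall>\<^sub>F n in sequentially. q i * (H (n - i) / H n) = a i n"
        by (rule eventually_mono[OF eventually_ge_at_top[of i]]) (simp add: a_def)
      ultimately show ?thesis using Lim_transform_eventually by force
    qed
    show "\<forall>\<^sub>F (i, n) in at_top \<times>\<^sub>F sequentially. norm (a i n) \<le> (1 + D) * (norm (q i) * 2 ^ i)"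
      unfolding eventually_prod_filter
      by (intro exI[of _ "\<lambda>_. True"] exI[of _ "\<lambda>n. n \<ge> N"]) (use bound in \<open>auto simp: eventually_ge_at_top\<close>)
    show "summable (\<lambda>i. (1 + D) * (norm (q i) * 2 ^ i))" by (rule summable_mult[OF q])
  qed simp
  moreover have "suminf (\<lambda>i. a i n) = (\<Sum>i\<le>n. q i * H (n - i)) / H n" for n
  proof -
    have "suminf (\<lambda>i. a i n) = (\<Sum>i\<le>n. a i n)" by (rule suminf_finite) (auto simp: a_def)
    then show ?thesis by (simp add: a_def sum_divide_distrib)
  qed
  ultimately show ?thesis by simp
qed

section \<open>Exponentials of formal power series\<close>

lemma fps_log_deriv_recurrence:
  fixes E F :: "'a::field_char_0 fps"
  assumes "fps_deriv E = E * fps_deriv F"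
  shows "of_nat n * fps_nth E n = (\<Sum>m=1..n. of_nat m * fps_nth F m * fps_nth E (n - m))"
proof (cases n)
  case (Suc k)
  have "of_nat n * fps_nth E n = fps_nth (fps_deriv F * E) k"
    using assms Suc by (metis fps_deriv_nth Suc_eq_plus1 mult.commute)
  also have "\<dots> = (\<Sum>i=0..k. of_nat (Suc i) * fps_nth F (Suc i) * fps_nth E (k - i))"
    by (simp add: fps_mult_nth)
  also have "\<dots> = (\<Sum>m=1..n. of_nat m * fps_nth F m * fps_nth E (n - m))"
    unfolding Suc by (rule sum.reindex_bij_witness[of _ "\<lambda>m. m - 1" Suc]) auto
  finally show ?thesis .
qed simp

lemma fps_deriv_exp_compose:
  fixes F :: "'a::field_char_0 fps"
  assumes "fps_nth F 0 = 0"
  shows "fps_deriv (fps_exp 1 oo F) = (fps_exp 1 oo F) * fps_deriv F"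
  using fps_compose_deriv[OF assms, of "fps_exp 1"] by simp

context
  fixes \<theta> :: "nat \<Rightarrow> real"
begin

definition g_fps :: "complex fps" where
  "g_fps = Abs_fps (g_coeff \<theta>)"

definition g_initial_fps :: "nat \<Rightarrow> complex fps" where
  "g_initial_fps b = (\<Sum>m\<le>b. fps_const (g_coeff \<theta> m) * fps_X ^ m)"

definition exp_g_fps :: "complex fps" where
  "exp_g_fps = fps_exp 1 oo g_fps"

definition exp_initial_fps :: "nat \<Rightarrow> complex fps" where
  "exp_initial_fps b = fps_exp 1 oo (- g_initial_fps b)"

lemma g_initial_fps_nth: "fps_nth (g_initial_fps b) n = (if n \<le> b then g_coeff \<theta> n else 0)"
proof -
  have "fps_nth (g_initial_fps b) n = (\<Sum>m\<le>b. if m = n then g_coeff \<theta> m else 0)"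
    unfolding g_initial_fps_def fps_sum_nth by (intro sum.cong) auto
  then show ?thesis by simp
qed

lemma g_coeff_0 [simp]: "g_coeff \<theta> 0 = 0" by (simp add: g_coeff_def)

text \<open>The product is the exponential of the terms of \<open>g\<close> beyond degree
  \<open>b\<close>, the exponential generating function of weighted permutations all of whose cycles
  are longer than \<open>b\<close>. The product rule for the logarithmic derivative gives the
  recurrence that removing a cycle will produce.\<close>

lemma tail_recurrence:
  "of_nat n * fps_nth (exp_initial_fps b * exp_g_fps) n =
     (\<Sum>m=1..n. (if m \<le> b then 0 else of_real (\<theta> m)) * fps_nth (exp_initial_fps b * exp_g_fps) (n - m))"
proof -
  have "fps_deriv (exp_initial_fps b * exp_g_fps) = (exp_initial_fps b * exp_g_fps) * fps_deriv (g_fps - g_initial_fps b)"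
  proof -
    have 1: "fps_deriv (exp_initial_fps b) = exp_initial_fps b * fps_deriv (- g_initial_fps b)"
      unfolding exp_initial_fps_def by (rule fps_deriv_exp_compose) (simp add: g_initial_fps_nth)
    have 2: "fps_deriv exp_g_fps = exp_g_fps * fps_deriv g_fps"
      unfolding exp_g_fps_def by (rule fps_deriv_exp_compose) (simp add: g_fps_def)
    show ?thesis unfolding fps_deriv_mult 1 2 by (simp add: algebra_simps)
  qed
  from fps_log_deriv_recurrence[OF this, of n] show ?thesis
    by (auto intro!: sum.cong simp: g_initial_fps_nth g_fps_def g_coeff_def)
qed

lemma tail_0: "fps_nth (exp_initial_fps b * exp_g_fps) 0 = 1"
  by (simp add: exp_initial_fps_def exp_g_fps_def)

lemma exp_initial_fps_0: "exp_initial_fps 0 = 1"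
  by (simp add: exp_initial_fps_def g_initial_fps_def)

lemma exp_initial_has_expansion:
  "(\<lambda>z. exp (- (\<Sum>m\<le>b. g_coeff \<theta> m * z ^ m))) has_fps_expansion exp_initial_fps b"
proof -
  have "(\<lambda>z. - (\<Sum>m\<le>b. g_coeff \<theta> m * z ^ m)) has_fps_expansion - g_initial_fps b"
    unfolding g_initial_fps_def by (intro fps_expansion_intros)
  from has_fps_expansion_compose[OF has_fps_expansion_exp1 this]
  show ?thesis by (simp add: exp_initial_fps_def g_initial_fps_nth o_def)
qed

lemma exp_initial_sums:
  "(\<lambda>i. fps_nth (exp_initial_fps b) i * z ^ i) sums exp (- (\<Sum>m\<le>b. g_coeff \<theta> m * z ^ m))"
  by (rule has_fps_expansion_imp_sums_complex[OF exp_initial_has_expansion, where r = \<infinity>])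
     (auto intro!: holomorphic_intros)

text \<open>The series is entire; convergence at 3 yields absolute convergence at 2, the weight used
  in \<open>convolution_ratio\<close>.\<close>

lemma exp_initial_abs_summable: "summable (\<lambda>i. norm (fps_nth (exp_initial_fps b) i) * 2 ^ i)"
proof -
  have "summable (\<lambda>i. norm (fps_nth (exp_initial_fps b) i * 2 ^ i))"
    by (rule powser_insidea[where x = 3]) (use exp_initial_sums[of b 3] in \<open>auto simp: sums_iff\<close>)
  then show ?thesis by (simp add: norm_mult norm_power)
qed

lemma exp_initial_suminf: "(\<Sum>i. fps_nth (exp_initial_fps b) i) = of_real (exp (- (\<Sum>m=1..b. \<theta> m / real m)))"
proof -
  have "(\<Sum>m\<le>b. g_coeff \<theta> m) = (\<Sum>m=1..b. complex_of_real (\<theta> m / real m))"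
    by (intro sum.mono_neutral_cong_right) (auto simp: g_coeff_def)
  then show ?thesis using exp_initial_sums[of b 1] by (simp add: sums_iff exp_of_real[symmetric])
qed

text \<open>Composition of expansions identifies the formal coefficients only near 0. Holomorphy on
  the unit disc then extends the convergence to the whole disc.\<close>

lemma exp_g_sums:
  assumes summ: "\<And>t. norm t < 1 \<Longrightarrow> summable (\<lambda>m. g_coeff \<theta> m * t ^ m)"
    and holo: "g_fun \<theta> holomorphic_on ball 0 1" and t: "norm t < 1"
  shows "(\<lambda>n. fps_nth exp_g_fps n * t ^ n) sums exp (g_fun \<theta> t)"
proof -
  have "fps_conv_radius g_fps \<ge> 1"
    unfolding fps_conv_radius_def
  proof (rule conv_radius_geI_ex)
    fix r :: real assume "0 < r" "ereal r < 1"
    then show "\<exists>z. norm z = r \<and> summable (\<lambda>n. fps_nth g_fps n * z ^ n)"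
      using summ[of "of_real r"] by (intro exI[of _ "of_real r"]) (auto simp: g_fps_def)
  qed
  then have "fps_conv_radius g_fps > 0" by (rule less_le_trans[rotated]) simp
  then have "g_fun \<theta> has_fps_expansion g_fps"
    by (simp add: has_fps_expansion_def eval_fps_def g_fun_def g_fps_def)
  from has_fps_expansion_compose[OF has_fps_expansion_exp1 this]
  have "(\<lambda>z. exp (g_fun \<theta> z)) has_fps_expansion exp_g_fps"
    by (simp add: exp_g_fps_def g_fps_def o_def)
  moreover have "(\<lambda>z. exp (g_fun \<theta> z)) holomorphic_on eball 0 1"
    using holo by (intro holomorphic_intros) (simp add: one_ereal_def)
  moreover have "ereal (norm t) < 1" using t by simp
  ultimately show ?thesis by (rule has_fps_expansion_imp_sums_complex)
qed

end

subsection \<open>Cycle counts of permutations\<close>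

text \<open>Stated for an arbitrary set because removing a cycle from \<open>{1..n}\<close> leaves a
  set of no special shape.\<close>

definition count_cycles :: "'a set \<Rightarrow> ('a \<Rightarrow> 'a) \<Rightarrow> nat \<Rightarrow> nat" where
  "count_cycles S \<sigma> m = card {c \<in> orbit \<sigma> ` S. card c = m}"

lemma permutes_orbit_eq:
  assumes "\<sigma> permutes S" "finite S" "y \<in> orbit \<sigma> x"
  shows "orbit \<sigma> y = orbit \<sigma> x"
proof -
  have "permutation \<sigma>" using assms permutation_permutes by blast
  then have "x \<in> orbit \<sigma> x" by (rule permutation_self_in_orbit)
  then have "x \<in> orbit \<sigma> y" using assms(3) by (rule orbit_swap)
  then show ?thesis using assms(3) by (blast intro: orbit_trans)
qed

lemma orbit_comp_disjoint:
  assumes "\<rho> permutes A" "\<tau> permutes B" "A \<inter> B = {}"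
  shows "y \<in> A \<Longrightarrow> orbit (\<rho> \<circ> \<tau>) y = orbit \<rho> y"
    and "y \<in> B \<Longrightarrow> orbit (\<rho> \<circ> \<tau>) y = orbit \<tau> y"
proof -
  have A: "(\<rho> \<circ> \<tau>) z = \<rho> z" if "z \<in> A" for z
    using permutes_not_in[OF assms(2), of z] that assms(3) by (metis comp_apply disjoint_iff)
  have B: "(\<rho> \<circ> \<tau>) z = \<tau> z" if "z \<in> B" for z
    using permutes_not_in[OF assms(1), of "\<tau> z"] permutes_in_image[OF assms(2), of z] that assms(3) by (metis comp_apply disjoint_iff)
  have rA: "\<rho> \<in> A \<rightarrow> A" and tB: "\<tau> \<in> B \<rightarrow> B"
    using permutes_in_image[OF assms(1)] permutes_in_image[OF assms(2)] by auto
  show "orbit (\<rho> \<circ> \<tau>) y = orbit \<rho> y" if "y \<in> A"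
    by (rule orbit_cong0[OF that rA, symmetric]) (simp only: A)
  show "orbit (\<rho> \<circ> \<tau>) y = orbit \<tau> y" if "y \<in> B"
    by (rule orbit_cong0[OF that tB, symmetric]) (simp only: B)
qed

lemma permutes_perm_restrict_orbit:
  assumes "finite S" "\<sigma> permutes S"
  shows "perm_restrict \<sigma> (orbit \<sigma> x) permutes orbit \<sigma> x"
    and "perm_restrict \<sigma> (S - orbit \<sigma> x) permutes (S - orbit \<sigma> x)"
    and "orbit (perm_restrict \<sigma> (orbit \<sigma> x)) x = orbit \<sigma> x"
    and "orbit \<sigma> x \<subseteq> S \<Longrightarrow> perm_restrict \<sigma> (orbit \<sigma> x) \<circ> perm_restrict \<sigma> (S - orbit \<sigma> x) = \<sigma>"
proof -
  have cyc: "cyclic_on \<sigma> (orbit \<sigma> x)" using assms(2,1) by (rule cyclic_on_orbit)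
  have perm: "permutation \<sigma>" using assms permutation_permutes by blast
  show "perm_restrict \<sigma> (S - orbit \<sigma> x) permutes (S - orbit \<sigma> x)"
    using assms(2) cyc by (rule perm_restrict_diff_cyclic)
  have "inj_on \<sigma> (orbit \<sigma> x)" using permutes_inj[OF assms(2)] by (rule inj_on_subset) simp
  moreover have "\<sigma> ` orbit \<sigma> x = orbit \<sigma> x"
  proof (intro equalityI subsetI)
    fix y assume y: "y \<in> orbit \<sigma> x"
    obtain z where "y = \<sigma> z" using permutes_surj[OF assms(2)] by (rule surjE)
    then show "y \<in> \<sigma> ` orbit \<sigma> x" using cyclic_on_f_in[OF assms(2) cyc] y by blast
  qed (use cyclic_on_inI[OF cyc] in blast)
  ultimately have "bij_betw \<sigma> (orbit \<sigma> x) (orbit \<sigma> x)"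
    unfolding bij_betw_def by (rule conjI)
  then have "bij_betw (perm_restrict \<sigma> (orbit \<sigma> x)) (orbit \<sigma> x) (orbit \<sigma> x)"
    by (subst bij_betw_cong[OF perm_restrict_simps(1)])
  then show "perm_restrict \<sigma> (orbit \<sigma> x) permutes orbit \<sigma> x"
    by (rule bij_imp_permutes) (rule perm_restrict_simps(2))
  show "orbit (perm_restrict \<sigma> (orbit \<sigma> x)) x = orbit \<sigma> x"
    by (rule orbit_cong[OF permutation_self_in_orbit[OF perm]]) (rule perm_restrict_simps(1))
  show "perm_restrict \<sigma> (orbit \<sigma> x) \<circ> perm_restrict \<sigma> (S - orbit \<sigma> x) = \<sigma>" if "orbit \<sigma> x \<subseteq> S"
  proof
    fix z
    have "\<sigma> z \<in> orbit \<sigma> x \<longleftrightarrow> z \<in> orbit \<sigma> x"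
      using cyclic_on_f_in[OF assms(2) cyc] cyclic_on_inI[OF cyc] by (rule iffI)
    then show "(perm_restrict \<sigma> (orbit \<sigma> x) \<circ> perm_restrict \<sigma> (S - orbit \<sigma> x)) z = \<sigma> z"
      using permutes_not_in[OF assms(2), of z] subsetD[OF that, of z] by (cases "z \<in> orbit \<sigma> x"; cases "z \<in> S") (simp_all add: perm_restrict_def)
  qed
qed

lemma perm_restrict_comp_disjoint:
  assumes "\<rho> permutes A" "\<tau> permutes B" "A \<inter> B = {}"
  shows "perm_restrict (\<rho> \<circ> \<tau>) A = \<rho>" "perm_restrict (\<rho> \<circ> \<tau>) B = \<tau>"
proof -
  show "perm_restrict (\<rho> \<circ> \<tau>) A = \<rho>"
  proof
    fix z show "perm_restrict (\<rho> \<circ> \<tau>) A z = \<rho> z"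
      using permutes_not_in[OF assms(1), of z] permutes_not_in[OF assms(2), of z] assms(3)
      by (metis comp_apply disjoint_iff perm_restrict_simps)
  qed
  show "perm_restrict (\<rho> \<circ> \<tau>) B = \<tau>"
  proof
    fix z show "perm_restrict (\<rho> \<circ> \<tau>) B z = \<tau> z"
      using permutes_in_image[OF assms(2), of z] permutes_not_in[OF assms(1), of "\<tau> z"]
        permutes_not_in[OF assms(2), of z] assms(3)
      by (auto simp: perm_restrict_def)
  qed
qed

text \<open>Both \<open>A\<close> and its complement are invariant, so restriction to each of them
  inverts the composition.\<close>

lemma bij_betw_permutes_orbit:
  assumes "finite S" "x \<in> A" "A \<subseteq> S"
  shows "bij_betw (\<lambda>(\<rho>, \<tau>). \<rho> \<circ> \<tau>)
           ({\<rho>. \<rho> permutes A \<and> orbit \<rho> x = A} \<times> {\<tau>. \<tau> permutes (S - A)})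
           {\<sigma>. \<sigma> permutes S \<and> orbit \<sigma> x = A}" (is "bij_betw _ ?P ?Q")
proof (rule bij_betw_byWitness[where f' = "\<lambda>\<sigma>. (perm_restrict \<sigma> A, perm_restrict \<sigma> (S - A))"])
  show "\<forall>p\<in>?P. (perm_restrict (case p of (\<rho>, \<tau>) \<Rightarrow> \<rho> \<circ> \<tau>) A,
      perm_restrict (case p of (\<rho>, \<tau>) \<Rightarrow> \<rho> \<circ> \<tau>) (S - A)) = p"
    using perm_restrict_comp_disjoint[of _ A _ "S - A"] by fastforce
  show "\<forall>\<sigma>\<in>?Q. (case (perm_restrict \<sigma> A, perm_restrict \<sigma> (S - A)) of (\<rho>, \<tau>) \<Rightarrow> \<rho> \<circ> \<tau>) = \<sigma>"
    using permutes_perm_restrict_orbit(4)[OF assms(1)] assms(3) by fastforce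
  have "\<rho> \<circ> \<tau> permutes S" "orbit (\<rho> \<circ> \<tau>) x = orbit \<rho> x"
    if h: "\<rho> permutes A" "\<tau> permutes (S - A)" for \<rho> \<tau>
  proof -
    show "\<rho> \<circ> \<tau> permutes S"
      using h assms(3) by (meson Diff_subset permutes_compose permutes_subset)
    show "orbit (\<rho> \<circ> \<tau>) x = orbit \<rho> x"
      using orbit_comp_disjoint(1)[OF h] assms(2) by blast
  qed
  then show "(\<lambda>(\<rho>, \<tau>). \<rho> \<circ> \<tau>) ` ?P \<subseteq> ?Q" by fastforce
  show "(\<lambda>\<sigma>. (perm_restrict \<sigma> A, perm_restrict \<sigma> (S - A))) ` ?Q \<subseteq> ?P"
    using permutes_perm_restrict_orbit(1-3)[OF assms(1)] by fastforce
qed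

lemma count_cycles_comp:
  assumes "finite S" "x \<in> A" "A \<subseteq> S" "\<rho> permutes A" "orbit \<rho> x = A" "\<tau> permutes (S - A)"
  shows "count_cycles S (\<rho> \<circ> \<tau>) = (count_cycles (S - A) \<tau>)(card A := Suc (count_cycles (S - A) \<tau> (card A)))"
proof
  fix m
  have fA: "finite A" using assms finite_subset by blast
  have "orbit (\<rho> \<circ> \<tau>) y = A" if "y \<in> A" for y
  proof -
    have "orbit (\<rho> \<circ> \<tau>) y = orbit \<rho> y"
      by (rule orbit_comp_disjoint(1)[OF assms(4,6) _ that]) simp
    also have "\<dots> = orbit \<rho> x"
      using assms(4) fA by (rule permutes_orbit_eq) (simp only: assms(5) that)
    finally show ?thesis by (simp only: assms(5))
  qed
  then have "orbit (\<rho> \<circ> \<tau>) ` A = (\<lambda>_. A) ` A" by (intro image_cong refl)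
  then have imA: "orbit (\<rho> \<circ> \<tau>) ` A = {A}" using image_constant[OF assms(2), of A] by (rule trans)
  have imB: "orbit (\<rho> \<circ> \<tau>) ` (S - A) = orbit \<tau> ` (S - A)"
    by (rule image_cong[OF refl], rule orbit_comp_disjoint(2)[OF assms(4,6)]) simp_all
  have "S = A \<union> (S - A)" using assms(3) by blast
  then have im: "orbit (\<rho> \<circ> \<tau>) ` S = insert A (orbit \<tau> ` (S - A))"
    using imA imB by (metis image_Un insert_is_Un)
  \<comment> \<open>Orbits are counted as sets, so the count at \<open>card A\<close> rises only
    because \<open>A\<close> is new: it contains \<open>x\<close>, and the orbits of
    \<open>\<tau>\<close> stay in \<open>S - A\<close>.\<close>
  have "A \<notin> orbit \<tau> ` (S - A)"
    using permutes_orbit_subset[OF assms(6)] assms(2) by blast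
  then show "count_cycles S (\<rho> \<circ> \<tau>) m = ((count_cycles (S - A) \<tau>)(card A := Suc (count_cycles (S - A) \<tau> (card A)))) m"
  proof (cases "m = card A")
    case True
    have "{c \<in> insert A (orbit \<tau> ` (S - A)). card c = m} = insert A {c \<in> orbit \<tau> ` (S - A). card c = m}"
      using True by auto
    then show ?thesis using True \<open>A \<notin> _\<close> assms(1) by (simp add: count_cycles_def im)
  next
    case False
    then have "{c \<in> insert A (orbit \<tau> ` (S - A)). card c = m} = {c \<in> orbit \<tau> ` (S - A). card c = m}"
      by auto
    then show ?thesis using False by (simp add: count_cycles_def im)
  qed
qed

text \<open>\<open>F\<close> is left general to serve twice: as the constant 1 it determines the
  number of full cycles, and then it carries the weights and the constraint on the counts.\<close>

lemma sum_permutes_split: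
  fixes F :: "(nat \<Rightarrow> nat) \<Rightarrow> 'b::comm_semiring_1"
  assumes "finite S" "x \<in> S"
  shows "(\<Sum>\<sigma> | \<sigma> permutes S. F (count_cycles S \<sigma>)) =
         (\<Sum>A | x \<in> A \<and> A \<subseteq> S. of_nat (card {\<rho>. \<rho> permutes A \<and> orbit \<rho> x = A}) *
            (\<Sum>\<tau> | \<tau> permutes (S - A). F ((count_cycles (S - A) \<tau>)(card A := Suc (count_cycles (S - A) \<tau> (card A))))))"
proof -
  have fin: "finite {A. x \<in> A \<and> A \<subseteq> S}" using assms by simp
  have "(\<Sum>\<sigma> | \<sigma> permutes S. F (count_cycles S \<sigma>)) =
    (\<Sum>A | x \<in> A \<and> A \<subseteq> S. \<Sum>\<sigma> | \<sigma> \<in> {\<sigma>. \<sigma> permutes S} \<and> orbit \<sigma> x = A. F (count_cycles S \<sigma>))"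
  proof (rule sum.group[symmetric])
    show "finite {\<sigma>. \<sigma> permutes S}" using assms by (simp add: finite_permutations)
    show "(\<lambda>\<sigma>. orbit \<sigma> x) ` {\<sigma>. \<sigma> permutes S} \<subseteq> {A. x \<in> A \<and> A \<subseteq> S}"
      using assms permutes_orbit_subset permutation_self_in_orbit permutation_permutes by fastforce
  qed (use fin in auto)
  also have "\<dots> = (\<Sum>A | x \<in> A \<and> A \<subseteq> S. of_nat (card {\<rho>. \<rho> permutes A \<and> orbit \<rho> x = A}) *
            (\<Sum>\<tau> | \<tau> permutes (S - A). F ((count_cycles (S - A) \<tau>)(card A := Suc (count_cycles (S - A) \<tau> (card A))))))"
  proof (rule sum.cong[OF refl], clarify)
    fix A assume A: "x \<in> A" "A \<subseteq> S"
    show "(\<Sum>\<sigma> | \<sigma> \<in> {\<sigma>. \<sigma> permutes S} \<and> orbit \<sigma> x = A. F (count_cycles S \<sigma>)) =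
      of_nat (card {\<rho>. \<rho> permutes A \<and> orbit \<rho> x = A}) *
            (\<Sum>\<tau> | \<tau> permutes (S - A). F ((count_cycles (S - A) \<tau>)(card A := Suc (count_cycles (S - A) \<tau> (card A)))))"
      using sum.reindex_bij_betw[OF bij_betw_permutes_orbit[OF assms(1) A], of "\<lambda>\<sigma>. F (count_cycles S \<sigma>)"]
        count_cycles_comp[OF assms(1) A]
      by (simp add: case_prod_unfold sum.cartesian_product' sum_distrib_left[symmetric] sum_distrib_right)
  qed
  finally show ?thesis .
qed

lemma sum_subsets_containing:
  fixes f :: "nat \<Rightarrow> 'b::comm_semiring_1"
  assumes "finite S" "x \<in> S"
  shows "(\<Sum>A | x \<in> A \<and> A \<subseteq> S. f (card A)) = (\<Sum>m=1..card S. of_nat ((card S - 1) choose (m - 1)) * f m)"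
proof -
  have "(\<Sum>A | x \<in> A \<and> A \<subseteq> S. f (card A)) = (\<Sum>B \<in> Pow (S - {x}). f (Suc (card B)))"
  proof (rule sum.reindex_bij_witness[of _ "insert x" "\<lambda>A. A - {x}"])
    fix A assume "A \<in> {A. x \<in> A \<and> A \<subseteq> S}"
    then show "f (Suc (card (A - {x}))) = f (card A)"
      using assms by (metis (no_types, lifting) card_Suc_Diff1 finite_subset mem_Collect_eq)
  qed (use assms in auto)
  also have "\<dots> = (\<Sum>j\<le>card S - 1. \<Sum>B | B \<in> Pow (S - {x}) \<and> card B = j. f (Suc (card B)))"
  proof (rule sum.group[symmetric])
    show "card ` Pow (S - {x}) \<subseteq> {..card S - 1}"
      using assms card_mono[of "S - {x}"] by auto
  qed (use assms in auto)
  also have "\<dots> = (\<Sum>j\<le>card S - 1. of_nat ((card S - 1) choose j) * f (Suc j))"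
  proof (rule sum.cong[OF refl])
    fix j
    have "card {B. B \<subseteq> S - {x} \<and> card B = j} = (card S - 1) choose j"
      using n_subsets[of "S - {x}" j] assms by simp
    then show "(\<Sum>B | B \<in> Pow (S - {x}) \<and> card B = j. f (Suc (card B))) = of_nat ((card S - 1) choose j) * f (Suc j)"
      by simp
  qed
  also have "\<dots> = (\<Sum>m=1..card S. of_nat ((card S - 1) choose (m - 1)) * f m)"
  proof (rule sum.reindex_bij_witness[of _ "\<lambda>m. m - 1" Suc])
    have "card S > 0" using assms by (auto simp: card_gt_0_iff)
    then show "j \<in> {..card S - 1} \<Longrightarrow> Suc j \<in> {1..card S}" for j by auto
  qed auto
  finally show ?thesis .
qed

text \<open>Splitting \<open>n!\<close> permutations by the orbit of \<open>x\<close> expresses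
  \<open>n!\<close> through the unknown numbers for all \<open>A\<close>. By induction these are
  known for proper subsets. Putting \<open>fact (card A - 1)\<close> for every \<open>A\<close> also
  sums to \<open>n!\<close>, as each of the \<open>n\<close> cardinalities contributes
  \<open>(n - 1)!\<close>; comparison leaves the value at \<open>S\<close>.\<close>

lemma card_full_cycles:
  assumes "finite S" "x \<in> S"
  shows "card {\<rho>. \<rho> permutes S \<and> orbit \<rho> x = S} = fact (card S - 1)"
  using assms
proof (induction "card S" arbitrary: S rule: less_induct)
  case less
  define z where "z S = card {\<rho>. \<rho> permutes S \<and> orbit \<rho> x = S}" for S
  define n where "n = card S"
  have n: "n \<ge> 1" using less.prems by (auto simp: n_def card_gt_0_iff intro: Suc_leI)
  have fin: "finite {A. x \<in> A \<and> A \<subseteq> S}" using less.prems by simp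
  have "fact n = (\<Sum>\<sigma> | \<sigma> permutes S. 1::nat)"
    using card_permutations[OF n_def[symmetric] less.prems(1)] by simp
  also have "\<dots> = (\<Sum>A | x \<in> A \<and> A \<subseteq> S. z A * fact (n - card A))"
    using sum_permutes_split[OF less.prems, of "\<lambda>_. 1::nat"] less.prems(1)
    by (auto simp: z_def n_def card_permutations[OF refl] card_Diff_subset finite_subset intro!: sum.cong)
  also have "\<dots> = z S + (\<Sum>A \<in> {A. x \<in> A \<and> A \<subseteq> S} - {S}. z A * fact (n - card A))"
    using sum.remove[OF fin, of S "\<lambda>A. z A * fact (n - card A)"] less.prems by (simp add: n_def)
  also have "(\<Sum>A \<in> {A. x \<in> A \<and> A \<subseteq> S} - {S}. z A * fact (n - card A)) =
     (\<Sum>A \<in> {A. x \<in> A \<and> A \<subseteq> S} - {S}. fact (card A - 1) * fact (n - card A))"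
  proof (rule sum.cong[OF refl])
    fix A assume "A \<in> {A. x \<in> A \<and> A \<subseteq> S} - {S}"
    then have "card A < card S" "finite A" "x \<in> A"
      using less.prems by (auto intro: psubset_card_mono finite_subset)
    from less.hyps[OF this] show "z A * fact (n - card A) = fact (card A - 1) * fact (n - card A)"
      by (simp add: z_def)
  qed
  \<comment> \<open>The added \<open>fact (n - 1)\<close> is the missing summand for
    \<open>A = S\<close> and completes the sum.\<close>
  also have "z S + \<dots> + fact (n - 1) = z S + (\<Sum>A | x \<in> A \<and> A \<subseteq> S. fact (card A - 1) * fact (n - card A))"
    using sum.remove[OF fin, of S "\<lambda>A. fact (card A - 1) * fact (n - card A) :: nat"] less.prems by (simp add: n_def)
  also have "(\<Sum>A | x \<in> A \<and> A \<subseteq> S. fact (card A - 1) * fact (n - card A) :: nat) =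
       (\<Sum>m=1..n. ((n - 1) choose (m - 1)) * (fact (m - 1) * fact (n - m)))"
    using sum_subsets_containing[OF less.prems, of "\<lambda>m. fact (m - 1) * fact (n - m) :: nat"] by (simp add: n_def)
  also have "\<dots> = (\<Sum>m=1..n. fact (n - 1))"
  proof (rule sum.cong[OF refl])
    fix m assume "m \<in> {1..n}"
    then have "m - 1 \<le> n - 1" by auto
    then show "((n - 1) choose (m - 1)) * (fact (m - 1) * fact (n - m)) = (fact (n - 1) :: nat)"
      using binomial_fact_lemma[of "m - 1" "n - 1"] \<open>m \<in> {1..n}\<close> by (simp add: algebra_simps)
  qed
  also have "\<dots> = fact n" using n by (simp add: fact_reduce)
  finally show ?case by (simp add: z_def n_def)
qed

section \<open>Weighted counts with prescribed numbers of short cycles\<close>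

lemma sum_permutes_recurrence:
  fixes F :: "(nat \<Rightarrow> nat) \<Rightarrow> 'b::{comm_semiring_1,semiring_char_0}"
  assumes "finite S" "x \<in> S"
  shows "(\<Sum>\<sigma> | \<sigma> permutes S. F (count_cycles S \<sigma>)) =
         (\<Sum>A | x \<in> A \<and> A \<subseteq> S. fact (card A - 1) *
            (\<Sum>\<tau> | \<tau> permutes (S - A). F ((count_cycles (S - A) \<tau>)(card A := Suc (count_cycles (S - A) \<tau> (card A))))))"
  unfolding sum_permutes_split[OF assms]
  using assms by (intro sum.cong) (auto simp: card_full_cycles finite_subset)

text \<open>The factor \<open>n\<close> splits as \<open>s c + (n - s c)\<close>. Lengths
  \<open>a \<le> b\<close> give the first part, because lowering \<open>c a\<close> by one gives
  \<open>\<theta> a * \<kappa> (c(a := c a - 1)) = a * c a * \<kappa> c\<close>; lengths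
  \<open>a > b\<close> give the second by the recurrence of \<open>V\<close>.\<close>

lemma sum_restricted_counts_recurrence:
  fixes \<theta> :: "nat \<Rightarrow> 'b::field_char_0" and V :: "nat \<Rightarrow> 'b" and b :: nat
  defines "\<kappa> \<equiv> \<lambda>c :: nat \<Rightarrow> nat. \<Prod>m=1..b. (\<theta> m / of_nat m) ^ c m / fact (c m)"
    and "s \<equiv> \<lambda>c :: nat \<Rightarrow> nat. \<Sum>m=1..b. m * c m"
  defines "R \<equiv> \<lambda>n c. if s c \<le> n then \<kappa> c * V (n - s c) else 0"
  assumes rec: "\<And>n. of_nat n * V n = (\<Sum>m=1..n. (if m \<le> b then 0 else \<theta> m) * V (n - m))"
  shows "(\<Sum>a=1..n. \<theta> a * (if a \<le> b then if c a = 0 then 0 else R (n - a) (c(a := c a - 1)) else R (n - a) c))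
           = of_nat n * R n c"
proof -
  have s_upd: "s c = a + s (c(a := c a - 1))" if "a \<in> {1..b}" "c a \<noteq> 0" for a
  proof -
    have "s c = a * c a + (\<Sum>m\<in>{1..b}-{a}. m * c m)"
      unfolding s_def using sum.remove[of "{1..b}" a "\<lambda>m. m * c m"] that by simp
    moreover have "s (c(a := c a - 1)) = a * (c a - 1) + (\<Sum>m\<in>{1..b}-{a}. m * c m)"
      unfolding s_def using sum.remove[of "{1..b}" a "\<lambda>m. m * (c(a := c a - 1)) m"] that by simp
    moreover have "a * c a = a + a * (c a - 1)" using that by (cases "c a") auto
    ultimately show ?thesis by simp
  qed
  have kappa_upd: "\<theta> a * \<kappa> (c(a := c a - 1)) = of_nat (a * c a) * \<kappa> c" if "a \<in> {1..b}" "c a \<noteq> 0" for a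
  proof -
    have e1: "\<kappa> c = (\<theta> a / of_nat a) ^ c a / fact (c a) * (\<Prod>m\<in>{1..b}-{a}. (\<theta> m / of_nat m) ^ c m / fact (c m))"
      unfolding \<kappa>_def using prod.remove[of "{1..b}" a "\<lambda>m. (\<theta> m / of_nat m) ^ c m / fact (c m)"] that by simp
    have e2: "\<kappa> (c(a := c a - 1)) = (\<theta> a / of_nat a) ^ (c a - 1) / fact (c a - 1) * (\<Prod>m\<in>{1..b}-{a}. (\<theta> m / of_nat m) ^ c m / fact (c m))"
      unfolding \<kappa>_def using prod.remove[of "{1..b}" a "\<lambda>m. (\<theta> m / of_nat m) ^ (c(a := c a - 1)) m / fact ((c(a := c a - 1)) m)"] that by simp
    have e3: "\<theta> a * ((\<theta> a / of_nat a) ^ (c a - 1) / fact (c a - 1)) = of_nat (a * c a) * ((\<theta> a / of_nat a) ^ c a / fact (c a))"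
    proof -
      obtain k where k: "c a = Suc k" using \<open>c a \<noteq> 0\<close> not0_implies_Suc by blast
      have aux: "t * (p / F) = x * y * (t / x * p / (y * F))" if "x \<noteq> 0" "y \<noteq> 0" "F \<noteq> 0" for t p F x y :: 'b
        using that by simp
      have "of_nat a \<noteq> (0::'b)" "of_nat (Suc k) \<noteq> (0::'b)" using that(1) by (auto simp del: of_nat_Suc)
      from aux[OF this fact_nonzero, of "\<theta> a" "(\<theta> a / of_nat a) ^ k" k] show ?thesis
        unfolding k fact_Suc power_Suc of_nat_mult by simp
    qed
    show ?thesis unfolding e1 e2 mult.assoc[symmetric] using e3 by (simp only: mult.assoc[symmetric])
  qed
  show ?thesis
  proof (cases "s c \<le> n")
    case False
    have "R (n - a) (c(a := c a - 1)) = 0" if "a \<in> {1..n}" "a \<le> b" "c a \<noteq> 0" for a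
      using s_upd[of a] that False by (auto simp: R_def)
    moreover have "R (n - a) c = 0" for a using False by (auto simp: R_def)
    ultimately show ?thesis using False by (auto intro!: sum.neutral simp: R_def)
  next
    case True
    have "(\<Sum>a=1..n. \<theta> a * (if a \<le> b then if c a = 0 then 0 else R (n - a) (c(a := c a - 1)) else R (n - a) c)) =
      (\<Sum>a=1..n. (if a \<le> b then of_nat (a * c a) * (\<kappa> c * V (n - s c)) else 0) + (if a \<le> b then 0 else \<theta> a) * R (n - a) c)"
    proof (rule sum.cong[OF refl])
      fix a assume a: "a \<in> {1..n}"
      show "\<theta> a * (if a \<le> b then if c a = 0 then 0 else R (n - a) (c(a := c a - 1)) else R (n - a) c) =
        (if a \<le> b then of_nat (a * c a) * (\<kappa> c * V (n - s c)) else 0) + (if a \<le> b then 0 else \<theta> a) * R (n - a) c"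
      proof (cases "a \<le> b \<and> c a \<noteq> 0")
        case ab: True
        then have "R (n - a) (c(a := c a - 1)) = \<kappa> (c(a := c a - 1)) * V (n - s c)"
          using s_upd[of a] a True by (simp add: R_def)
        then show ?thesis using kappa_upd[of a] ab a by (simp add: mult.assoc[symmetric])
      qed auto
    qed
    also have "\<dots> = (\<Sum>a=1..n. if a \<le> b then of_nat (a * c a) * (\<kappa> c * V (n - s c)) else 0) +
        (\<Sum>a=1..n. (if a \<le> b then 0 else \<theta> a) * R (n - a) c)"
      by (rule sum.distrib)
    also have "(\<Sum>a=1..n. if a \<le> b then of_nat (a * c a) * (\<kappa> c * V (n - s c)) else 0) =
        (\<Sum>a=1..b. of_nat (a * c a) * (\<kappa> c * V (n - s c)))"
    proof (rule sum.mono_neutral_cong)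
      fix a assume "a \<in> {1..b} - {1..n}"
      \<comment> \<open>A length \<open>a > n \<ge> s c\<close> cannot occur, as one such cycle
        alone would exceed \<open>s c\<close>.\<close>
      then have "c a = 0" using s_upd[of a] True by (cases "c a = 0") auto
      then show "of_nat (a * c a) * (\<kappa> c * V (n - s c)) = 0" by simp
    qed auto
    also have "\<dots> = of_nat (s c) * (\<kappa> c * V (n - s c))"
      unfolding s_def by (simp add: sum_distrib_right)
    also have "(\<Sum>a=1..n. (if a \<le> b then 0 else \<theta> a) * R (n - a) c) =
        (\<Sum>a=1..n - s c. (if a \<le> b then 0 else \<theta> a) * (\<kappa> c * V (n - s c - a)))"
      using True by (intro sum.mono_neutral_cong_right) (auto simp: R_def add.commute)
    also have "\<dots> = \<kappa> c * (of_nat (n - s c) * V (n - s c))"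
      unfolding rec sum_distrib_left by (intro sum.cong) auto
    finally show ?thesis using True by (simp add: R_def of_nat_diff algebra_simps)
  qed
qed

text \<open>Induction on the size of \<open>S\<close> with \<open>c\<close> free, since removing a
  short cycle lowers an entry of \<open>c\<close>. The weight runs up to a fixed \<open>M\<close>
  rather than \<open>card S\<close>, so it keeps its form on \<open>S - A\<close>; counts of lengths
  above \<open>card S\<close> are 0.\<close>

lemma sum_permutes_restricted_counts:
  fixes \<theta> :: "nat \<Rightarrow> 'b::field_char_0" and V :: "nat \<Rightarrow> 'b" and b :: nat
  defines "\<kappa> \<equiv> \<lambda>c :: nat \<Rightarrow> nat. \<Prod>m=1..b. (\<theta> m / of_nat m) ^ c m / fact (c m)"
    and "s \<equiv> \<lambda>c :: nat \<Rightarrow> nat. \<Sum>m=1..b. m * c m"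
  assumes V0: "V 0 = 1"
    and rec: "\<And>n. of_nat n * V n = (\<Sum>m=1..n. (if m \<le> b then 0 else \<theta> m) * V (n - m))"
    and S: "finite S" "card S \<le> M"
  shows "(\<Sum>\<sigma> | \<sigma> permutes S. (\<Prod>m=1..M. \<theta> m ^ count_cycles S \<sigma> m) *
            (if \<forall>m\<in>{1..b}. count_cycles S \<sigma> m = c m then 1 else 0)) =
         fact (card S) * (if s c \<le> card S then \<kappa> c * V (card S - s c) else 0)"
  using S
proof (induction "card S" arbitrary: S c rule: less_induct)
  case less
  define F where "F = (\<lambda>c C. (\<Prod>m=1..M. \<theta> m ^ C m) * (if \<forall>m\<in>{1..b}. C m = c m then 1 else (0::'b)))"
  define R where "R = (\<lambda>n c. if s c \<le> n then \<kappa> c * V (n - s c) else 0)"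
  \<comment> \<open>One more cycle of length \<open>a\<close> contributes a factor
    \<open>\<theta> a\<close>. For \<open>a \<le> b\<close> the constraint passes to
    \<open>c a - 1\<close>; the case \<open>c a = 0\<close> is separated because the subtraction is
    truncated.\<close>
  have F_Suc: "F c (C(a := Suc (C a))) = \<theta> a * (if a \<le> b then if c a = 0 then 0 else F (c(a := c a - 1)) C else F c C)"
    if a: "a \<in> {1..M}" for c C a
  proof -
    have "(\<Prod>m=1..M. \<theta> m ^ (C(a := Suc (C a))) m)
        = \<theta> a ^ Suc (C a) * (\<Prod>m\<in>{1..M} - {a}. \<theta> m ^ (C(a := Suc (C a))) m)"
      using prod.remove[OF finite_atLeastAtMost a, of "\<lambda>m. \<theta> m ^ (C(a := Suc (C a))) m"] by (simp only: fun_upd_same)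
    also have "(\<Prod>m\<in>{1..M} - {a}. \<theta> m ^ (C(a := Suc (C a))) m) = (\<Prod>m\<in>{1..M} - {a}. \<theta> m ^ C m)"
      by (rule prod.cong) simp_all
    also have "\<theta> a ^ Suc (C a) * \<dots> = \<theta> a * (\<Prod>m=1..M. \<theta> m ^ C m)"
      using prod.remove[OF finite_atLeastAtMost a, of "\<lambda>m. \<theta> m ^ C m"] by (simp only: power_Suc mult.assoc)
    finally have weight: "(\<Prod>m=1..M. \<theta> m ^ (C(a := Suc (C a))) m) = \<theta> a * (\<Prod>m=1..M. \<theta> m ^ C m)" .
    have counts: "(\<forall>m\<in>{1..b}. (C(a := Suc (C a))) m = c m) \<longleftrightarrow>
       (if a \<le> b then c a \<noteq> 0 \<and> (\<forall>m\<in>{1..b}. C m = (c(a := c a - 1)) m) else (\<forall>m\<in>{1..b}. C m = c m))"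
    proof (cases "a \<le> b")
      case True
      then have ab: "a \<in> {1..b}" using a by simp
      have eq: "(C(a := Suc (C a))) m = c m \<longleftrightarrow> (m = a \<longrightarrow> c a \<noteq> 0) \<and> C m = (c(a := c a - 1)) m" for m
        by (cases "c a") auto
      show ?thesis unfolding eq using ab True by (simp only: if_True) blast
    qed auto
    show ?thesis unfolding F_def weight counts by simp
  qed
  have "(\<Sum>\<sigma> | \<sigma> permutes S. F c (count_cycles S \<sigma>)) = fact (card S) * R (card S) c"
  proof (cases "S = {}")
    case True
    have "count_cycles {} \<sigma> = (\<lambda>_. 0)" for \<sigma> :: "'a \<Rightarrow> 'a" by (auto simp: count_cycles_def)
    moreover have "(\<forall>m\<in>{1..b}. 0 = c m) \<longleftrightarrow> s c = 0" by (auto simp: s_def)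
    moreover have "\<kappa> c = 1" if "\<forall>m\<in>{1..b}. 0 = c m" using that by (simp add: \<kappa>_def prod.neutral)
    ultimately show ?thesis using True V0 by (simp add: F_def R_def)
  next
    case False
    then obtain x where x: "x \<in> S" by blast
    define n where "n = card S"
    have n: "n \<ge> 1" using x less.prems by (auto simp: n_def card_gt_0_iff intro: Suc_leI)
    define D where "D = (\<lambda>a. \<theta> a * (if a \<le> b then if c a = 0 then 0 else R (n - a) (c(a := c a - 1)) else R (n - a) c))"
    have "(\<Sum>\<sigma> | \<sigma> permutes S. F c (count_cycles S \<sigma>)) = 
         (\<Sum>A | x \<in> A \<and> A \<subseteq> S. fact (card A - 1) *
            (\<Sum>\<tau> | \<tau> permutes (S - A). F c ((count_cycles (S - A) \<tau>)(card A := Suc (count_cycles (S - A) \<tau> (card A))))))"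
      by (rule sum_permutes_recurrence[OF less.prems(1) x])
    also have "\<dots> = (\<Sum>A | x \<in> A \<and> A \<subseteq> S. fact (card A - 1) * (fact (n - card A) * D (card A)))"
    proof (rule sum.cong[OF refl])
      fix A assume "A \<in> {A. x \<in> A \<and> A \<subseteq> S}"
      then have A: "x \<in> A" "A \<subseteq> S" by auto
      have fA: "finite A" using A less.prems finite_subset by blast
      have cA: "card A \<in> {1..M}" 
        using A fA less.prems card_mono[of S A] by (auto simp: card_gt_0_iff intro!: Suc_leI)
      have cS: "card (S - A) = n - card A" using A fA by (simp add: n_def card_Diff_subset)
      have "card (S - A) < card S" using cS cA n by (simp add: n_def)
      then have IH: "(\<Sum>\<tau> | \<tau> permutes (S - A). F c' (count_cycles (S - A) \<tau>)) = fact (n - card A) * R (n - card A) c'" for c'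
        using less.hyps[of "S - A" c'] less.prems cS by (simp add: F_def R_def)
      show "fact (card A - 1) *
            (\<Sum>\<tau> | \<tau> permutes (S - A). F c ((count_cycles (S - A) \<tau>)(card A := Suc (count_cycles (S - A) \<tau> (card A))))) =
         fact (card A - 1) * (fact (n - card A) * D (card A))"
        unfolding F_Suc[OF cA] sum_distrib_left[symmetric]
        using IH[of c] IH[of "c(card A := c (card A) - 1)"] by (simp add: D_def)
    qed
    also have "\<dots> = (\<Sum>a=1..n. of_nat ((n - 1) choose (a - 1)) * (fact (a - 1) * (fact (n - a) * D a)))"
      using sum_subsets_containing[OF less.prems(1) x, of "\<lambda>a. fact (a - 1) * (fact (n - a) * D a)"]
      by (simp add: n_def)
    also have "\<dots> = (\<Sum>a=1..n. fact (n - 1) * D a)"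
    proof (rule sum.cong[OF refl])
      fix a assume "a \<in> {1..n}"
      then have "a - 1 \<le> n - 1" "n - 1 - (a - 1) = n - a" by auto
      then have "fact (a - 1) * fact (n - a) * ((n - 1) choose (a - 1)) = (fact (n - 1) :: nat)"
        using binomial_fact_lemma[of "a - 1" "n - 1"] by simp
      then have "of_nat (fact (a - 1) * fact (n - a) * ((n - 1) choose (a - 1))) = (fact (n - 1) :: 'b)"
        by (metis of_nat_fact)
      then have "fact (a - 1) * fact (n - a) * of_nat ((n - 1) choose (a - 1)) = (fact (n - 1) :: 'b)"
        by simp
      then show "of_nat ((n - 1) choose (a - 1)) * (fact (a - 1) * (fact (n - a) * D a)) = fact (n - 1) * D a"
        by (metis (no_types, lifting) mult.assoc mult.commute)
    qed
    also have "\<dots> = fact (n - 1) * (\<Sum>a=1..n. D a)" by (simp add: sum_distrib_left)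
    also have "(\<Sum>a=1..n. D a) = of_nat n * R n c"
      unfolding D_def R_def s_def \<kappa>_def by (rule sum_restricted_counts_recurrence[OF rec])
    finally show ?thesis using n by (simp add: n_def fact_reduce)
  qed
  then show ?case by (simp add: F_def R_def)
qed

subsection \<open>Convergence of mass functions\<close>

text \<open>The difference of the integrands vanishes where \<open>Z\<close> takes values in
  \<open>K\<close> and is at most \<open>B\<close> elsewhere, so the error is \<open>B\<close> times
  the mass outside \<open>K\<close>.\<close>

lemma expectation_finite_approx:
  fixes f :: "'c \<Rightarrow> real"
  assumes "prob_space M" and Z: "Z \<in> M \<rightarrow>\<^sub>M count_space S" and K: "finite K" "K \<subseteq> S"
    and f: "\<And>c. c \<in> S \<Longrightarrow> \<bar>f c\<bar> \<le> B"
  shows "\<bar>(LINT x|M. f (Z x)) - (\<Sum>c\<in>K. f c * measure M (Z -` {c} \<inter> space M))\<bar>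
           \<le> B * (1 - (\<Sum>c\<in>K. measure M (Z -` {c} \<inter> space M)))"
proof -
  interpret prob_space M by fact
  define E where "E c = Z -` {c} \<inter> space M" for c
  have E: "E c \<in> sets M" if "c \<in> K" for c
    unfolding E_def using K that by (intro measurable_sets[OF Z]) auto
  have ZS: "Z x \<in> S" if "x \<in> space M" for x using measurable_space[OF Z that] by simp
  have int_f: "integrable M (\<lambda>x. f (Z x))"
  proof (rule integrable_const_bound[where B = B])
    show "AE x in M. norm (f (Z x)) \<le> B" by (rule AE_I2) (use f ZS in auto)
    show "(\<lambda>x. f (Z x)) \<in> borel_measurable M" by (rule measurable_compose[OF Z]) simp
  qed
  have int_E: "integrable M (\<lambda>x. a * indicator (E c) x)" if "c \<in> K" for a :: real and c
    using E[OF that] by (intro integrable_mult_right) (simp add: integrable_indicator_iff less_top[symmetric])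
  have "(LINT x|M. f (Z x)) - (\<Sum>c\<in>K. f c * measure M (E c)) = (LINT x|M. f (Z x) - (\<Sum>c\<in>K. f c * indicator (E c) x))"
    using int_f int_E E by (subst Bochner_Integration.integral_diff) (auto simp: Bochner_Integration.integral_sum)
  also have "norm \<dots> \<le> (LINT x|M. B * (1 - (\<Sum>c\<in>K. 1 * indicator (E c) x)))"
  proof (rule order_trans[OF integral_norm_bound], rule integral_mono)
    show "integrable M (\<lambda>x. norm (f (Z x) - (\<Sum>c\<in>K. f c * indicator (E c) x)))"
      using int_f int_E by (intro integrable_norm Bochner_Integration.integrable_diff Bochner_Integration.integrable_sum) auto
    show "integrable M (\<lambda>x. B * (1 - (\<Sum>c\<in>K. 1 * indicator (E c) x)))"
      using int_E by (intro Bochner_Integration.integrable_diff Bochner_Integration.integrable_sum integrable_mult_right) auto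
    fix x assume x: "x \<in> space M"
    have *: "(\<Sum>c\<in>K. a c * indicator (E c) x) = (if Z x \<in> K then a (Z x) else 0)" for a :: "'c \<Rightarrow> real"
    proof -
      have "(\<Sum>c\<in>K. a c * indicator (E c) x) = (\<Sum>c\<in>K. if c = Z x then a c else 0)"
        using x by (intro sum.cong) (auto simp: E_def indicator_def)
      then show ?thesis using K(1) by simp
    qed
    show "norm (f (Z x) - (\<Sum>c\<in>K. f c * indicator (E c) x)) \<le> B * (1 - (\<Sum>c\<in>K. 1 * indicator (E c) x))"
      unfolding * using f[OF ZS[OF x]] by auto
  qed
  also have "(LINT x|M. B * (1 - (\<Sum>c\<in>K. 1 * indicator (E c) x))) = B * (1 - (\<Sum>c\<in>K. measure M (E c)))"
  proof -
    have int1: "integrable M (indicator (E c) :: 'a \<Rightarrow> real)" if "c \<in> K" for c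
      using int_E[OF that, of 1] by simp
    have "(LINT x|M. 1 - (\<Sum>c\<in>K. indicator (E c) x :: real)) = (LINT x|M. 1) - (\<Sum>c\<in>K. LINT x|M. indicator (E c) x)"
      using int1 by (subst Bochner_Integration.integral_diff) (auto simp: Bochner_Integration.integral_sum)
    also have "\<dots> = 1 - (\<Sum>c\<in>K. measure M (E c))"
      using E prob_space by simp
    finally show ?thesis by simp
  qed
  finally show ?thesis by (simp add: E_def)
qed

text \<open>
  Scheffe's argument: pointwise convergence of mass functions to a mass function of total mass one
  leaves no mass to escape.
\<close>
lemma expectation_tendsto_of_mass_tendsto:
  fixes f :: "'c \<Rightarrow> real"
  assumes M: "\<forall>\<^sub>F n in sequentially. prob_space (M n)" and Z: "\<And>n. Z n \<in> M n \<rightarrow>\<^sub>M count_space S"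
    and N: "prob_space N" and W: "W \<in> N \<rightarrow>\<^sub>M count_space S"
    and K: "\<And>j. finite (K j)" "incseq K" "(\<Union>j. K j) = S"
    and mass: "\<And>c. c \<in> S \<Longrightarrow> (\<lambda>n. measure (M n) (Z n -` {c} \<inter> space (M n))) \<longlonglongrightarrow> measure N (W -` {c} \<inter> space N)"
    and f: "bounded (f ` S)"
  shows "(\<lambda>n. LINT x|M n. f (Z n x)) \<longlonglongrightarrow> (LINT x|N. f (W x))"
proof -
  interpret N: prob_space N by fact
  obtain B where B: "\<forall>c\<in>S. \<bar>f c\<bar> \<le> B" using f by (auto simp: bounded_iff)
  have B1: "\<bar>f c\<bar> \<le> max B 1" if "c \<in> S" for c using B that by (auto intro: le_max_iff_disj[THEN iffD2])
  define p where "p n c = measure (M n) (Z n -` {c} \<inter> space (M n))" for n c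
  define q where "q c = measure N (W -` {c} \<inter> space N)" for c
  have KS: "K j \<subseteq> S" for j using K(3) by auto
  have mK: "measure N (W -` K j \<inter> space N) = (\<Sum>c\<in>K j. q c)" for j
  proof -
    have "W -` K j \<inter> space N = (\<Union>c\<in>K j. W -` {c} \<inter> space N)" by auto
    also have "measure N \<dots> = (\<Sum>c\<in>K j. q c)"
      unfolding q_def using K(1) KS[of j]
      by (intro N.finite_measure_finite_Union) (auto simp: disjoint_family_on_def intro!: measurable_sets[OF W])
    finally show ?thesis .
  qed
  have "(\<lambda>j. measure N (W -` K j \<inter> space N)) \<longlonglongrightarrow> measure N (\<Union>j. W -` K j \<inter> space N)"
  proof (rule N.finite_Lim_measure_incseq)
    show "range (\<lambda>j. W -` K j \<inter> space N) \<subseteq> sets N" using KS by (auto intro!: measurable_sets[OF W])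
    show "incseq (\<lambda>j. W -` K j \<inter> space N)" using K(2) by (fastforce simp: incseq_def)
  qed
  moreover have "(\<Union>j. W -` K j \<inter> space N) = space N"
    using K(3) measurable_space[OF W] by auto
  ultimately have lim1: "(\<lambda>j. \<Sum>c\<in>K j. q c) \<longlonglongrightarrow> 1" using N.prob_space by (simp add: mK)
  show ?thesis
  proof (rule tendstoI)
    fix e :: real assume e: "e > 0"
    have "(\<lambda>j. 2 * max B 1 * (1 - (\<Sum>c\<in>K j. q c))) \<longlonglongrightarrow> 2 * max B 1 * (1 - 1)"
      by (intro tendsto_intros lim1)
    then have "\<forall>\<^sub>F j in sequentially. 2 * max B 1 * (1 - (\<Sum>c\<in>K j. q c)) < e"
      using order_tendstoD(2) e by fastforce
    \<comment> \<open>The factor 2 accounts for two tails outside \<open>K j\<close>, one of the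
      approximating law and one of the limit law; the former converges to the latter.\<close>
    then obtain j where j: "2 * max B 1 * (1 - (\<Sum>c\<in>K j. q c)) < e"
      using eventually_happens'[OF sequentially_bot] by blast
    have "(\<lambda>n. \<bar>(\<Sum>c\<in>K j. f c * p n c) - (\<Sum>c\<in>K j. f c * q c)\<bar> + max B 1 * (1 - (\<Sum>c\<in>K j. p n c)) + max B 1 * (1 - (\<Sum>c\<in>K j. q c)))
      \<longlonglongrightarrow> \<bar>(\<Sum>c\<in>K j. f c * q c) - (\<Sum>c\<in>K j. f c * q c)\<bar> + max B 1 * (1 - (\<Sum>c\<in>K j. q c)) + max B 1 * (1 - (\<Sum>c\<in>K j. q c))"
      unfolding p_def q_def using KS[of j] by (intro tendsto_intros mass) auto
    then have "\<forall>\<^sub>F n in sequentially. \<bar>(\<Sum>c\<in>K j. f c * p n c) - (\<Sum>c\<in>K j. f c * q c)\<bar> + max B 1 * (1 - (\<Sum>c\<in>K j. p n c)) + max B 1 * (1 - (\<Sum>c\<in>K j. q c)) < e"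
      by (rule order_tendstoD(2)) (use j in simp)
    then show "\<forall>\<^sub>F n in sequentially. dist (LINT x|M n. f (Z n x)) (LINT x|N. f (W x)) < e"
      using M
    proof eventually_elim
      case (elim n)
      have "\<bar>(LINT x|M n. f (Z n x)) - (\<Sum>c\<in>K j. f c * p n c)\<bar> \<le> max B 1 * (1 - (\<Sum>c\<in>K j. p n c))"
        unfolding p_def by (rule expectation_finite_approx[OF elim(2) Z K(1) KS B1])
      moreover have "\<bar>(LINT x|N. f (W x)) - (\<Sum>c\<in>K j. f c * q c)\<bar> \<le> max B 1 * (1 - (\<Sum>c\<in>K j. q c))"
        unfolding q_def by (rule expectation_finite_approx[OF N W K(1) KS B1])
      ultimately show ?case using elim(1) unfolding dist_real_def by linarith
    qed
  qed
qed

section \<open>Laws of vectors with countably many values\<close>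

lemma prob_distributed_count_space:
  assumes "distributed N (count_space UNIV) X (\<lambda>j. ennreal (p j))" "p i \<ge> 0"
  shows "measure N (X -` {i} \<inter> space N) = p i"
proof -
  have "emeasure N (X -` {i} \<inter> space N) = (\<integral>\<^sup>+ x. ennreal (p x) * indicator {i} x \<partial>count_space UNIV)"
    by (rule distributed_emeasure[OF assms(1)]) simp
  also have "\<dots> = ennreal (p i)" by simp
  finally show ?thesis using assms(2) by (simp add: measure_def)
qed

lemma countable_vector_measurable:
  fixes Y :: "'i \<Rightarrow> 'a \<Rightarrow> 'b::countable"
  assumes "finite I" "\<And>i. i \<in> I \<Longrightarrow> Y i \<in> N \<rightarrow>\<^sub>M count_space UNIV"
  shows "(\<lambda>\<omega>. \<lambda>i\<in>I. Y i \<omega>) \<in> N \<rightarrow>\<^sub>M count_space (PiE I (\<lambda>_. UNIV))"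
proof (subst measurable_count_space_eq_countable)
  show "countable (PiE I (\<lambda>_. UNIV :: 'b set))" using assms(1) by (intro countable_PiE) auto
  have "(\<lambda>\<omega>. \<lambda>i\<in>I. Y i \<omega>) -` {c} \<inter> space N \<in> sets N" if c: "c \<in> PiE I (\<lambda>_. UNIV)" for c
  proof -
    have "(\<lambda>\<omega>. \<lambda>i\<in>I. Y i \<omega>) -` {c} \<inter> space N = {\<omega> \<in> space N. \<forall>i\<in>I. Y i \<omega> = c i}"
      using c by (auto simp: fun_eq_iff PiE_def extensional_def)
    also have "\<dots> = {\<omega> \<in> space N. \<forall>i\<in>I. \<omega> \<in> Y i -` {c i} \<inter> space N}" by auto
    also have "\<dots> \<in> sets N"
      using assms by (intro sets.sets_Collect_finite_All) (auto intro: measurable_sets)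
    finally show ?thesis .
  qed
  then show "(\<lambda>\<omega>. \<lambda>i\<in>I. Y i \<omega>) \<in> space N \<rightarrow> PiE I (\<lambda>_. UNIV) \<and>
      (\<forall>c\<in>PiE I (\<lambda>_. UNIV). (\<lambda>\<omega>. \<lambda>i\<in>I. Y i \<omega>) -` {c} \<inter> space N \<in> sets N)"
    by auto
qed

lemma indep_vars_vector_prob:
  assumes N: "prob_space N" and ind: "prob_space.indep_vars N (\<lambda>_. count_space UNIV) Y I"
    and I: "finite I" "I \<noteq> {}" and c: "c \<in> PiE I (\<lambda>_. UNIV)"
  shows "measure N ((\<lambda>\<omega>. \<lambda>i\<in>I. Y i \<omega>) -` {c} \<inter> space N) = (\<Prod>i\<in>I. measure N (Y i -` {c i} \<inter> space N))"
proof -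
  interpret prob_space N by fact
  \<comment> \<open>Nonemptiness of \<open>I\<close> matters: an empty intersection would be the
    whole type instead of \<open>space N\<close>.\<close>
  have "(\<lambda>\<omega>. \<lambda>i\<in>I. Y i \<omega>) -` {c} \<inter> space N = (\<Inter>i\<in>I. Y i -` {c i} \<inter> space N)"
    using c I(2) by (auto simp: fun_eq_iff PiE_def extensional_def)
  also have "measure N \<dots> = (\<Prod>i\<in>I. measure N (Y i -` {c i} \<inter> space N))"
    by (rule indep_varsD[OF ind I(2,1)]) auto
  finally show ?thesis .
qed

subsection \<open>Cycle counts under the weighted measure\<close>

lemma standing_assumptions_coefficient_ratio:
  assumes "standing_assumptions \<theta>"
  shows "\<forall>\<^sub>F n in sequentially. fps_nth (exp_g_fps \<theta>) n \<noteq> 0"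
    and "(\<lambda>n. fps_nth (exp_g_fps \<theta>) n / fps_nth (exp_g_fps \<theta>) (Suc n)) \<longlonglongrightarrow> 1"
proof -
  from assms have summ: "\<And>t. norm t < 1 \<Longrightarrow> summable (\<lambda>m. g_coeff \<theta> m * t ^ m)"
    and holo: "g_fun \<theta> holomorphic_on ball 0 1"
    by (auto simp: standing_assumptions_def)
  from assms obtain G k c where G: "continuous_on (cball 0 1 - {1}) G" "\<forall>t\<in>ball 0 1. G t = g_fun \<theta> t"
    and k: "k \<ge> 1"
    and O: "(\<lambda>w. G (exp (- w)) - log_poly k c (- Ln w)) \<in> O[at 0 within {w. 0 \<le> Re w}](\<lambda>w. w)"
    unfolding standing_assumptions_def Let_def log_poly_def by blast
  from landau_o.bigE[OF O] obtain C where C: "C > 0"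
    and ev: "\<forall>\<^sub>F w in at 0 within {w. 0 \<le> Re w}. norm (G (exp (- w)) - log_poly k c (- Ln w)) \<le> C * norm w"
    by auto
  from ev obtain d where d: "d > 0"
    "\<And>w. Re w \<ge> 0 \<Longrightarrow> w \<noteq> 0 \<Longrightarrow> norm w < d \<Longrightarrow> norm (G (exp (- w)) - log_poly k c (- Ln w)) \<le> C * norm w"
    unfolding eventually_at by auto
  \<comment> \<open>Halving \<open>d\<close> turns the open disc of the neighbourhood filter into
    the closed one of the locale.\<close>
  interpret log_singularity G k c "min (d / 2) (exp (-1))" C
  proof
    show "norm (G (exp (- w)) - log_poly k c (- Ln w)) \<le> C * norm w"
      if "Re w \<ge> 0" "w \<noteq> 0" "norm w \<le> min (d / 2) (exp (-1))" for w
      using that d(1) by (intro d(2)) auto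
  qed (use k G d C in auto)
  have "(\<lambda>n. fps_nth (exp_g_fps \<theta>) n * t ^ n) sums exp (G t)" if "norm t < 1" for t
    using exp_g_sums[OF summ holo that] G(2) that by simp
  from coefficient_ratio[OF this]
  show "\<forall>\<^sub>F n in sequentially. fps_nth (exp_g_fps \<theta>) n \<noteq> 0"
    and "(\<lambda>n. fps_nth (exp_g_fps \<theta>) n / fps_nth (exp_g_fps \<theta>) (Suc n)) \<longlonglongrightarrow> 1"
    by auto
qed

text \<open>The quotient factors through \<open>H (n - s)\<close>: the convolution limit applies at
  the shifted index, and \<open>H (n - s) / H n\<close> tends to 1.\<close>

lemma tail_coefficient_ratio:
  assumes "standing_assumptions \<theta>"
  shows "(\<lambda>n. fps_nth (exp_initial_fps \<theta> b * exp_g_fps \<theta>) (n - s) / fps_nth (exp_g_fps \<theta>) n)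
           \<longlonglongrightarrow> of_real (exp (- (\<Sum>m=1..b. \<theta> m / real m)))"
proof -
  define H where "H = fps_nth (exp_g_fps \<theta>)"
  note nz = standing_assumptions_coefficient_ratio(1)[OF assms, folded H_def]
  note ratio = standing_assumptions_coefficient_ratio(2)[OF assms, folded H_def]
  have sub: "filterlim (\<lambda>n. n - s) sequentially sequentially"
    by (rule filterlim_minus_const_nat_at_top)
  have V: "fps_nth (exp_initial_fps \<theta> b * exp_g_fps \<theta>) n = (\<Sum>i\<le>n. fps_nth (exp_initial_fps \<theta> b) i * H (n - i))" for n
    by (simp add: fps_mult_nth H_def atLeast0AtMost)
  have "(\<lambda>n. (\<Sum>i\<le>n. fps_nth (exp_initial_fps \<theta> b) i * H (n - i)) / H n) \<longlonglongrightarrow> of_real (exp (- (\<Sum>m=1..b. \<theta> m / real m)))"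
    unfolding exp_initial_suminf[symmetric] by (rule convolution_ratio[OF nz ratio exp_initial_abs_summable])
  from tendsto_mult[OF filterlim_compose[OF this sub] ratio_limit_shift[OF nz ratio, of s]]
  have "(\<lambda>n. fps_nth (exp_initial_fps \<theta> b * exp_g_fps \<theta>) (n - s) / H (n - s) * (H (n - s) / H n))
      \<longlonglongrightarrow> of_real (exp (- (\<Sum>m=1..b. \<theta> m / real m)))"
    unfolding V by simp
  moreover have "\<forall>\<^sub>F n in sequentially. fps_nth (exp_initial_fps \<theta> b * exp_g_fps \<theta>) (n - s) / H (n - s) * (H (n - s) / H n) =
      fps_nth (exp_initial_fps \<theta> b * exp_g_fps \<theta>) (n - s) / H n"
    using eventually_compose_filterlim[OF nz sub] by eventually_elim simp
  ultimately show ?thesis unfolding H_def by (rule Lim_transform_eventually)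
qed

lemma cycle_count_eq: "cycle_count n = count_cycles {1..n}"
  by (simp add: fun_eq_iff cycle_count_def count_cycles_def)

lemma sum_cycle_weight_restricted:
  fixes c :: "nat \<Rightarrow> nat"
  shows "complex_of_real (\<Sum>\<sigma> | \<sigma> permutes {1..n} \<and> (\<forall>m\<in>{1..b}. cycle_count n \<sigma> m = c m). cycle_weight \<theta> n \<sigma>) =
     fact n * (if (\<Sum>m=1..b. m * c m) \<le> n
               then of_real (\<Prod>m=1..b. (\<theta> m / real m) ^ c m / fact (c m)) *
                    fps_nth (exp_initial_fps \<theta> b * exp_g_fps \<theta>) (n - (\<Sum>m=1..b. m * c m)) else 0)"
proof -
  have "complex_of_real (\<Sum>\<sigma> | \<sigma> permutes {1..n} \<and> (\<forall>m\<in>{1..b}. cycle_count n \<sigma> m = c m). cycle_weight \<theta> n \<sigma>) =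
     (\<Sum>\<sigma> | \<sigma> permutes {1..n}. (\<Prod>m=1..n. complex_of_real (\<theta> m) ^ count_cycles {1..n} \<sigma> m) *
            (if \<forall>m\<in>{1..b}. count_cycles {1..n} \<sigma> m = c m then 1 else 0))"
    unfolding of_real_sum
    by (rule sum.mono_neutral_cong_left)
       (auto simp: finite_permutations cycle_weight_def cycle_count_eq)
  also have "\<dots> = fact (card {1..n}) * (if (\<Sum>m=1..b. m * c m) \<le> card {1..n}
     then (\<Prod>m=1..b. (complex_of_real (\<theta> m) / of_nat m) ^ c m / fact (c m)) *
       fps_nth (exp_initial_fps \<theta> b * exp_g_fps \<theta>) (card {1..n} - (\<Sum>m=1..b. m * c m)) else 0)"
    by (rule sum_permutes_restricted_counts[OF tail_0 tail_recurrence]) auto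
  finally show ?thesis by (simp add: of_real_prod)
qed

text \<open>The case \<open>b = 0\<close> of the restricted sum: no count is prescribed, and the
  factor for short cycles is 1.\<close>

lemma norm_const_eq: "complex_of_real (norm_const \<theta> n) = fps_nth (exp_g_fps \<theta>) n"
proof -
  have "complex_of_real (\<Sum>\<sigma> | \<sigma> permutes {1..n}. cycle_weight \<theta> n \<sigma>) = fact n * fps_nth (exp_g_fps \<theta>) n"
    using sum_cycle_weight_restricted[where b = 0 and n = n and \<theta> = \<theta>] by (simp add: exp_initial_fps_0)
  then show ?thesis by (simp add: norm_const_def)
qed

lemma cycle_weight_nonneg: "(\<And>m. m \<ge> 1 \<Longrightarrow> 0 \<le> \<theta> m) \<Longrightarrow> 0 \<le> cycle_weight \<theta> n \<sigma>"
  unfolding cycle_weight_def by (intro prod_nonneg) auto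

text \<open>Some \<open>\<theta> m\<close> may vanish, so the sum over permutations shows only
  nonnegativity; that it is not 0 for large \<open>n\<close> comes from the saddle point.\<close>

lemma norm_const_eventually_pos:
  assumes "standing_assumptions \<theta>"
  shows "\<forall>\<^sub>F n in sequentially. norm_const \<theta> n > 0"
  using standing_assumptions_coefficient_ratio(1)[OF assms]
proof eventually_elim
  case (elim n)
  have "0 \<le> norm_const \<theta> n" unfolding norm_const_def
    using assms by (intro divide_nonneg_nonneg sum_nonneg cycle_weight_nonneg) (auto simp: standing_assumptions_def)
  moreover have "norm_const \<theta> n \<noteq> 0" using elim by (metis norm_const_eq of_real_0)
  ultimately show ?case by simp
qed

lemma emeasure_perm_measure:
  assumes "\<And>m. m \<ge> 1 \<Longrightarrow> 0 \<le> \<theta> m" "norm_const \<theta> n > 0" "A \<subseteq> {\<sigma>. \<sigma> permutes {1..n}}"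
  shows "emeasure (perm_measure \<theta> n) A = ennreal ((\<Sum>\<sigma>\<in>A. cycle_weight \<theta> n \<sigma>) / (norm_const \<theta> n * fact n))"
proof -
  have "finite A" using assms(3) finite_permutations[of "{1..n}"] finite_subset by blast
  then have "emeasure (perm_measure \<theta> n) A = (\<Sum>\<sigma>\<in>A. ennreal (1 / (norm_const \<theta> n * fact n) * cycle_weight \<theta> n \<sigma>))"
    unfolding perm_measure_def using assms(3) by (rule emeasure_point_measure_finite2[rotated])
  also have "\<dots> = ennreal (\<Sum>\<sigma>\<in>A. 1 / (norm_const \<theta> n * fact n) * cycle_weight \<theta> n \<sigma>)"
    using assms by (intro sum_ennreal) (simp add: cycle_weight_nonneg)
  finally show ?thesis by (simp add: sum_divide_distrib)
qed

lemma prob_space_perm_measure: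
  assumes "\<And>m. m \<ge> 1 \<Longrightarrow> 0 \<le> \<theta> m" "norm_const \<theta> n > 0"
  shows "prob_space (perm_measure \<theta> n)"
proof
  have "space (perm_measure \<theta> n) = {\<sigma>. \<sigma> permutes {1..n}}" by (simp add: perm_measure_def space_point_measure)
  moreover have "(\<Sum>\<sigma> | \<sigma> permutes {1..n}. cycle_weight \<theta> n \<sigma>) = norm_const \<theta> n * fact n"
    by (simp add: norm_const_def)
  ultimately show "emeasure (perm_measure \<theta> n) (space (perm_measure \<theta> n)) = 1"
    using emeasure_perm_measure[OF assms order_refl] assms(2) by simp
qed

lemma cycle_counts_mass_tendsto:
  assumes "standing_assumptions \<theta>" "c \<in> PiE {1..b} (\<lambda>_. UNIV)"
  shows "(\<lambda>n. measure (perm_measure \<theta> n)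
            ((\<lambda>\<sigma>. \<lambda>m\<in>{1..b}. cycle_count n \<sigma> m) -` {c} \<inter> space (perm_measure \<theta> n)))
          \<longlonglongrightarrow> (\<Prod>m=1..b. poisson_density (\<theta> m / real m) (c m))"
proof -
  have nonneg: "0 \<le> \<theta> m" if "m \<ge> 1" for m using assms(1) that by (simp add: standing_assumptions_def)
  define s where "s = (\<Sum>m=1..b. m * c m)"
  define \<kappa> where "\<kappa> = (\<Prod>m=1..b. (\<theta> m / real m) ^ c m / fact (c m))"
  define V where "V = fps_nth (exp_initial_fps \<theta> b * exp_g_fps \<theta>)"
  define H where "H = fps_nth (exp_g_fps \<theta>)"
  define p where "p n = measure (perm_measure \<theta> n)
            ((\<lambda>\<sigma>. \<lambda>m\<in>{1..b}. cycle_count n \<sigma> m) -` {c} \<inter> space (perm_measure \<theta> n))" for n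
  \<comment> \<open>The coefficient limits are complex, so the probabilities are embedded and the
    embedding is removed at the end by \<open>tendsto_of_real_iff\<close>.\<close>
  have "\<forall>\<^sub>F n in sequentially. of_real \<kappa> * (V (n - s) / H n) = complex_of_real (p n)"
    using norm_const_eventually_pos[OF assms(1)] eventually_ge_at_top[of s]
  proof eventually_elim
    case (elim n)
    define A where "A = {\<sigma>. \<sigma> permutes {1..n} \<and> (\<forall>m\<in>{1..b}. cycle_count n \<sigma> m = c m)}"
    have "(\<lambda>\<sigma>. \<lambda>m\<in>{1..b}. cycle_count n \<sigma> m) -` {c} \<inter> space (perm_measure \<theta> n) = A"
      using assms(2) by (auto simp: A_def perm_measure_def space_point_measure fun_eq_iff PiE_def extensional_def)
    moreover have "emeasure (perm_measure \<theta> n) A = ennreal ((\<Sum>\<sigma>\<in>A. cycle_weight \<theta> n \<sigma>) / (norm_const \<theta> n * fact n))"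
      by (rule emeasure_perm_measure[OF nonneg elim(1)]) (auto simp: A_def)
    moreover have "(\<Sum>\<sigma>\<in>A. cycle_weight \<theta> n \<sigma>) / (norm_const \<theta> n * fact n) \<ge> 0"
      using elim(1) by (intro divide_nonneg_nonneg sum_nonneg cycle_weight_nonneg nonneg) auto
    ultimately have "p n = (\<Sum>\<sigma>\<in>A. cycle_weight \<theta> n \<sigma>) / (norm_const \<theta> n * fact n)"
      by (simp add: p_def measure_def)
    then have "complex_of_real (p n) = of_real (\<Sum>\<sigma>\<in>A. cycle_weight \<theta> n \<sigma>) / (of_real (norm_const \<theta> n) * fact n)"
      by (simp only: of_real_divide of_real_mult of_real_fact)
    also have "\<dots> = fact n * (of_real \<kappa> * V (n - s)) / (H n * fact n)"
      unfolding A_def sum_cycle_weight_restricted norm_const_eq s_def[symmetric] \<kappa>_def[symmetric] V_def H_def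
      using elim(2) by simp
    finally show ?case by simp
  qed
  moreover have "(\<lambda>n. of_real \<kappa> * (V (n - s) / H n)) \<longlonglongrightarrow> of_real \<kappa> * of_real (exp (- (\<Sum>m=1..b. \<theta> m / real m)))"
    unfolding V_def H_def by (intro tendsto_mult tendsto_const tail_coefficient_ratio assms(1))
  ultimately have "(\<lambda>n. complex_of_real (p n)) \<longlonglongrightarrow> of_real (\<kappa> * exp (- (\<Sum>m=1..b. \<theta> m / real m)))"
    using Lim_transform_eventually by force
  then have "p \<longlonglongrightarrow> \<kappa> * exp (- (\<Sum>m=1..b. \<theta> m / real m))"
    by (simp only: tendsto_of_real_iff)
  moreover have "\<kappa> * exp (- (\<Sum>m=1..b. \<theta> m / real m)) = (\<Prod>m=1..b. poisson_density (\<theta> m / real m) (c m))"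
    unfolding poisson_density_def prod.distrib \<kappa>_def by (simp add: exp_sum sum_negf[symmetric])
  ultimately show ?thesis by (simp add: p_def[abs_def])
qed

theorem theorem3p1:
  fixes \<theta> :: "nat \<Rightarrow> real" and b :: nat
    and N :: "'a measure" and Y :: "nat \<Rightarrow> 'a \<Rightarrow> nat"
  assumes "standing_assumptions \<theta>"
    and "1 \<le> b"
    and "prob_space N"
    and "prob_space.indep_vars N (\<lambda>_. count_space UNIV) Y {1..b}"
    and "\<And>m. m \<in> {1..b} \<Longrightarrow>
           distributed N (count_space UNIV) (Y m) (\<lambda>j. ennreal (poisson_density (\<theta> m / real m) j))"
  shows "conv_in_distr (powertop_real {1..b})
           (perm_measure \<theta>) (\<lambda>n \<sigma>. \<lambda>m\<in>{1..b}. real (cycle_count n \<sigma> m))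
           N (\<lambda>\<omega>. \<lambda>m\<in>{1..b}. real (Y m \<omega>))"
  unfolding conv_in_distr_def
proof (intro allI impI, elim conjE)
  fix f :: "(nat \<Rightarrow> real) \<Rightarrow> real"
  assume f: "bounded (f ` topspace (powertop_real {1..b}))"
  \<comment> \<open>All laws are carried by vectors of natural numbers; composing \<open>f\<close>
    with their embedding into real vectors reduces the claim to a countable set.\<close>
  define S where "S = PiE {1..b} (\<lambda>_. UNIV :: nat set)"
  define h where "h c = f (\<lambda>m\<in>{1..b}. real (c m))" for c
  define Z where "Z n \<sigma> = (\<lambda>m\<in>{1..b}. cycle_count n \<sigma> m)" for n \<sigma>
  define W where "W \<omega> = (\<lambda>m\<in>{1..b}. Y m \<omega>)" for \<omega>
  have nonneg: "0 \<le> \<theta> m" if "m \<ge> 1" for m using assms(1) that by (simp add: standing_assumptions_def)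
  have Y_meas: "Y m \<in> N \<rightarrow>\<^sub>M count_space UNIV" if "m \<in> {1..b}" for m
    using assms(5)[OF that] by (simp add: distributed_def)
  have W_mass: "measure N (W -` {c} \<inter> space N) = (\<Prod>m=1..b. poisson_density (\<theta> m / real m) (c m))" if "c \<in> S" for c
  proof -
    have "measure N (W -` {c} \<inter> space N) = (\<Prod>m\<in>{1..b}. measure N (Y m -` {c m} \<inter> space N))"
      unfolding W_def using assms(2) that by (intro indep_vars_vector_prob assms(3,4)) (auto simp: S_def)
    also have "\<dots> = (\<Prod>m=1..b. poisson_density (\<theta> m / real m) (c m))"
      using nonneg by (intro prod.cong refl prob_distributed_count_space assms(5)) (auto simp: poisson_density_def)
    finally show ?thesis .
  qed
  have "(\<lambda>n. LINT \<sigma>|perm_measure \<theta> n. h (Z n \<sigma>)) \<longlonglongrightarrow> (LINT \<omega>|N. h (W \<omega>))"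
  \<comment> \<open>The finite boxes exhaust \<open>S\<close>, since each vector lies in the box
    whose side is the sum of its entries.\<close>
  proof (rule expectation_tendsto_of_mass_tendsto[where S = S and K = "\<lambda>j. PiE {1..b} (\<lambda>_. {..j})"])
    show "\<forall>\<^sub>F n in sequentially. prob_space (perm_measure \<theta> n)"
      using norm_const_eventually_pos[OF assms(1)]
      by eventually_elim (rule prob_space_perm_measure[OF nonneg])
    show "Z n \<in> perm_measure \<theta> n \<rightarrow>\<^sub>M count_space S" for n
      by (rule measurableI) (auto simp: perm_measure_def sets_point_measure space_point_measure Z_def S_def)
    show "W \<in> N \<rightarrow>\<^sub>M count_space S"
      unfolding W_def S_def by (intro countable_vector_measurable Y_meas) auto
    show "finite (PiE {1..b} (\<lambda>_. {..j}))" for j :: nat by (intro finite_PiE) auto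
    show "incseq (\<lambda>j :: nat. PiE {1..b} (\<lambda>_. {..j}))"
      by (auto simp: incseq_def intro!: PiE_mono)
    show "(\<Union>j :: nat. PiE {1..b} (\<lambda>_. {..j})) = S"
    proof (intro equalityI subsetI)
      fix c assume c: "c \<in> S"
      have "c m \<le> (\<Sum>m=1..b. c m)" if "m \<in> {1..b}" for m using that by (intro member_le_sum) auto
      then have "c \<in> PiE {1..b} (\<lambda>_. {..\<Sum>m=1..b. c m})" using c by (auto simp: S_def PiE_def)
      then show "c \<in> (\<Union>j :: nat. PiE {1..b} (\<lambda>_. {..j}))" by blast
    qed (auto simp: S_def PiE_def)
    show "(\<lambda>n. measure (perm_measure \<theta> n) (Z n -` {c} \<inter> space (perm_measure \<theta> n))) \<longlonglongrightarrow> measure N (W -` {c} \<inter> space N)"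
      if "c \<in> S" for c
      unfolding W_mass[OF that] Z_def using that unfolding S_def by (rule cycle_counts_mass_tendsto[OF assms(1)])
    have "h ` S \<subseteq> f ` topspace (powertop_real {1..b})"
      by (auto simp: h_def topspace_product_topology)
    then show "bounded (h ` S)" using f bounded_subset by blast
  qed (rule assms(3))
  moreover have "(\<lambda>m\<in>{1..b}. real ((\<lambda>m\<in>{1..b}. x m) m)) = (\<lambda>m\<in>{1..b}. real (x m))" for x :: "nat \<Rightarrow> nat"
    by (auto simp: fun_eq_iff)
  ultimately show "(\<lambda>n. LINT \<sigma>|perm_measure \<theta> n. f (\<lambda>m\<in>{1..b}. real (cycle_count n \<sigma> m)))
      \<longlonglongrightarrow> (LINT \<omega>|N. f (\<lambda>m\<in>{1..b}. real (Y m \<omega>)))"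
    by (simp only: h_def Z_def W_def)
qed

end
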